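(* Let $\sigma:\Sigma\to\Sigma$ be a transitive one-sided subshift of finite type and let $A\in C^\theta(\hat\Sigma)$. Assume that the function $f:\Omega(A)\to\mathbb R$ is bounded from below. Then $$u(\bar{\mathbf x})=\inf_{\mathbf x\in\Omega(A)}\bigl[f(\mathbf x)+S_A(\mathbf x,\bar{\mathbf x})\bigr],\qquad \bar{\mathbf x}\in\Sigma,$$ defines a $\theta$-Hölder calibrated sub-action for $A$. Moreover, if $f(\bar{\mathbf x})-f(\mathbf x)\le S_A(\mathbf x,\bar{\mathbf x})$ for all $\mathbf x,\bar{\mathbf x}\in\Omega(A)$, then $u=f$ on $\Omega(A)$.
   Context: Let $\mathbf M$ be an $r\times r$ matrix with entries in $\{0,1\}$. The one-sided subshift of finite type is $\Sigma=\{\mathbf x=(x_0,x_1,\ldots)\in\{1,\ldots,r\}^{\mathbb N}:\mathbf M(x_j,x_{j+1})=1\ \forall j\ge 0\}$ (nonempty), with the left shift $\sigma(x_0,x_1,\ldots)=(x_1,x_2,\ldots)$. Fix $\lambda\in(0,1)$; $\Sigma$ has the metric $d(\mathbf x,\bar{\mathbf x})=\lambda^{k}$, $k=\min\{j:x_j\ne\bar x_j\}$ (and $d(\mathbf x,\mathbf x)=0$). The dual space is $\Sigma^*=\{\mathbf y=(\ldots,y_1,y_0)\in\{1,\ldots,r\}^{\mathbb N}:\mathbf M(y_{j+1},y_j)=1\ \forall j\ge0\}$, with the analogous metric. Let $\hat\Sigma=\{(\mathbf y,\mathbf x)\in\Sigma^*\times\Sigma:\mathbf M(y_0,x_0)=1\}$,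 with the maximum metric induced from the product. Define $\tau:\hat\Sigma\to\Sigma$ by $\tau(\mathbf y,\mathbf x)=\tau_{\mathbf y}(\mathbf x)=(y_0,x_0,x_1,\ldots)$, and for $\mathbf x\in\Sigma$ let $\Sigma^*_{\mathbf x}=\{\mathbf y\in\Sigma^*:(\mathbf y,\mathbf x)\in\hat\Sigma\}$. $C^0(\cdot)$ denotes real-valued continuous functions and $C^\theta(\cdot)$ (with $\theta>0$) the $\theta$-Hölder ones. Transitive means topologically transitive: for all nonempty open $D,E\subset\Sigma$ there is $k\ge1$ with $\sigma^k(D)\cap E\neq\emptyset$. The set $\mathcal M_0$ of holonomic probabilities is the set of Borel probability measures $\hat\mu$ on $\hat\Sigma$ such that $\int f(\tau_{\mathbf y}(\mathbf x))\,d\hat\mu(\mathbf y,\mathbf x)=\int f(\mathbf x)\,d\hat\mu(\mathbf y,\mathbf x)$ for all $f\in C^0(\Sigma)$. For $A\in C^0(\hat\Sigma)$, $\beta_A=\max_{\hat\mu\in\mathcal M_0}\int_{\hat\Sigma}A\,d\hat\mu$. A calibrated sub-action for $A$ is $u\in C^0(\Sigma)$ with $u(\mathbf x)=\min_{\mathbf y\in\Sigma^*_{\mathbf x}}[u(\tau_{\mathbf y}(\mathbf x))-A(\mathbf y,\mathbf x)+\beta_A]$ for all $\mathbf x\in\Sigma$. For $\epsilon>0$ and $\mathbf x,\bar{\mathbf x}\in\Sigma$, $\mathcal P(\mathbf x,\bar{\mathbf x},\epsilon)$ is the set of finite sequences (paths) $(\mathbf y^0,\mathbf x^0),\ldots,(\mathbf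 y^{k-1},\mathbf x^{k-1})\in\hat\Sigma$, $k\ge1$, with $\mathbf x^0=\bar{\mathbf x}$, $\mathbf x^{j+1}=\tau_{\mathbf y^j}(\mathbf x^j)$ for $0\le j<k-1$, and $d(\tau_{\mathbf y^{k-1}}(\mathbf x^{k-1}),\mathbf x)<\epsilon$. The set of non-wandering points $\Omega(A)$ consists of those $\mathbf x\in\Sigma$ such that for every $\epsilon>0$ there is a path in $\mathcal P(\mathbf x,\mathbf x,\epsilon)$ with $|\sum_{j=0}^{k-1}(A-\beta_A)(\mathbf y^j,\mathbf x^j)|<\epsilon$. The Mañé potential $S_A:\Sigma\times\Sigma\to\mathbb R\cup\{\pm\infty\}$ is $S_A(\mathbf x,\bar{\mathbf x})=\lim_{\epsilon\to0}S_A^\epsilon(\mathbf x,\bar{\mathbf x})$, where $S_A^\epsilon(\mathbf x,\bar{\mathbf x})=\inf\bigl[-\sum_{j=0}^{k-1}(A-\beta_A)(\mathbf y^j,\mathbf x^j)\bigr]$, the infimum being over all paths in $\mathcal P(\mathbf x,\bar{\mathbf x},\epsilon)$ ($\inf\emptyset=+\infty$). *)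

theory Defs
  imports "HOL-Probability.Probability"
begin

type_synonym symseq = "nat \<Rightarrow> nat"

definition shift_space :: "nat \<Rightarrow> (nat \<Rightarrow> nat \<Rightarrow> nat) \<Rightarrow> symseq set" where
  "shift_space r M = {x. (\<forall>j. x j \<in> {1..r}) \<and> (\<forall>j. M (x j) (x (Suc j)) = 1)}"

text \<open>A point \<open>(\<dots>, y\<^sub>1, y\<^sub>0)\<close> of the dual space is stored as the function \<open>j \<mapsto> y\<^sub>j\<close>.\<close>

definition dual_space :: "nat \<Rightarrow> (nat \<Rightarrow> nat \<Rightarrow> nat) \<Rightarrow> symseq set" where
  "dual_space r M = {y. (\<forall>j. y j \<in> {1..r}) \<and> (\<forall>j. M (y (Suc j)) (y j) = 1)}"

definition hat_space :: "nat \<Rightarrow> (nat \<Rightarrow> nat \<Rightarrow> nat) \<Rightarrow> (symseq \<times> symseq) set" where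
  "hat_space r M = {(y, x). y \<in> dual_space r M \<and> x \<in> shift_space r M \<and> M (y 0) (x 0) = 1}"

definition dual_fibre :: "nat \<Rightarrow> (nat \<Rightarrow> nat \<Rightarrow> nat) \<Rightarrow> symseq \<Rightarrow> symseq set" where
  "dual_fibre r M x = {y \<in> dual_space r M. (y, x) \<in> hat_space r M}"

definition left_shift :: "symseq \<Rightarrow> symseq" where
  "left_shift x = (\<lambda>j. x (Suc j))"

definition tau :: "symseq \<times> symseq \<Rightarrow> symseq" where
  "tau = (\<lambda>(y, x). case_nat (y 0) x)"

definition seq_dist :: "real \<Rightarrow> symseq \<Rightarrow> symseq \<Rightarrow> real" where
  "seq_dist lam x x' = (if x = x' then 0 else lam ^ (LEAST j. x j \<noteq> x' j))"

definition hat_dist :: "real \<Rightarrow> symseq \<times> symseq \<Rightarrow> symseq \<times> symseq \<Rightarrow> real" where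
  "hat_dist lam p q = max (seq_dist lam (fst p) (fst q)) (seq_dist lam (snd p) (snd q))"

text \<open>\<open>Metric_space.mtopology\<close> is only meaningful for an actual metric, which the next lemmas provide.\<close>

lemma seq_dist_ultra:
  assumes "0 < lam" "lam < 1"
  shows "seq_dist lam x z \<le> max (seq_dist lam x y) (seq_dist lam y z)"
proof (cases "x = z \<or> x = y \<or> y = z")
  case True
  then show ?thesis using assms by (auto simp: seq_dist_def le_max_iff_disj)
next
  case False
  define k where "k = (LEAST j. x j \<noteq> z j)"
  obtain i where "x i \<noteq> z i" using False by blast
  then have k: "x k \<noteq> z k"
    unfolding k_def by (rule LeastI)
  then consider "x k \<noteq> y k" | "y k \<noteq> z k" by metis
  then show ?thesis
  proof cases
    case 1
    then have "(LEAST j. x j \<noteq> y j) \<le> k" by (rule Least_le)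
    then have "lam ^ k \<le> lam ^ (LEAST j. x j \<noteq> y j)"
      using assms by (intro power_decreasing) auto
    then show ?thesis using False by (simp add: seq_dist_def k_def[symmetric] le_max_iff_disj)
  next
    case 2
    then have "(LEAST j. y j \<noteq> z j) \<le> k" by (rule Least_le)
    then have "lam ^ k \<le> lam ^ (LEAST j. y j \<noteq> z j)"
      using assms by (intro power_decreasing) auto
    then show ?thesis using False by (simp add: seq_dist_def k_def[symmetric] le_max_iff_disj)
  qed
qed

lemma seq_dist_nonneg: "0 < lam \<Longrightarrow> 0 \<le> seq_dist lam x y"
  by (simp add: seq_dist_def)

lemma seq_dist_commute: "seq_dist lam x y = seq_dist lam y x"
proof -
  have "(LEAST j. x j \<noteq> y j) = (LEAST j. y j \<noteq> x j)"
    by (rule arg_cong[where f = Least], rule ext) metis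
  moreover have "x = y \<longleftrightarrow> y = x" by blast
  ultimately show ?thesis unfolding seq_dist_def by presburger
qed

lemma seq_dist_eq_0: "0 < lam \<Longrightarrow> seq_dist lam x y = 0 \<longleftrightarrow> x = y"
  by (simp add: seq_dist_def)

lemma Metric_space_seq_dist:
  assumes "0 < lam" "lam < 1"
  shows "Metric_space S (seq_dist lam)"
proof
  fix x y z
  show "seq_dist lam x z \<le> seq_dist lam x y + seq_dist lam y z"
    using seq_dist_ultra[OF assms, of x z y] seq_dist_nonneg[OF assms(1), of x y]
      seq_dist_nonneg[OF assms(1), of y z] by linarith
  show "seq_dist lam x y = seq_dist lam y x"
    by (rule seq_dist_commute)
qed (use assms in \<open>simp_all add: seq_dist_nonneg seq_dist_eq_0\<close>)

lemma Metric_space_hat_dist: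
  assumes "0 < lam" "lam < 1"
  shows "Metric_space S (hat_dist lam)"
proof
  fix p q s :: "symseq \<times> symseq"
  note nonneg = seq_dist_nonneg[OF assms(1)]
  show "0 \<le> hat_dist lam p q"
    by (simp add: hat_dist_def nonneg le_max_iff_disj)
  show "hat_dist lam p q = hat_dist lam q p"
    unfolding hat_dist_def
    by (simp only: seq_dist_commute[of lam "fst p" "fst q"] seq_dist_commute[of lam "snd p" "snd q"])
  have max_0: "max a b = 0 \<longleftrightarrow> a = 0 \<and> b = 0" if "0 \<le> a" "0 \<le> b" for a b :: real
    using that by (auto simp: max_def)
  show "hat_dist lam p q = 0 \<longleftrightarrow> p = q"
    by (simp add: hat_dist_def max_0[OF nonneg nonneg] seq_dist_eq_0[OF assms(1)] prod_eq_iff)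
  have max_le: "max a b \<le> max a' b' + max a'' b''" if "a \<le> a' + a''" "b \<le> b' + b''"
    for a b a' b' a'' b'' :: real
    using that by linarith
  show "hat_dist lam p s \<le> hat_dist lam p q + hat_dist lam q s"
    unfolding hat_dist_def
    by (intro max_le Metric_space.triangle[OF Metric_space_seq_dist[OF assms, of UNIV]]) simp_all
qed

definition shift_topology :: "nat \<Rightarrow> (nat \<Rightarrow> nat \<Rightarrow> nat) \<Rightarrow> real \<Rightarrow> symseq topology" where
  "shift_topology r M lam = Metric_space.mtopology (shift_space r M) (seq_dist lam)"

definition hat_topology ::
    "nat \<Rightarrow> (nat \<Rightarrow> nat \<Rightarrow> nat) \<Rightarrow> real \<Rightarrow> (symseq \<times> symseq) topology" where
  "hat_topology r M lam = Metric_space.mtopology (hat_space r M) (hat_dist lam)"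

definition topologically_transitive :: "'a topology \<Rightarrow> ('a \<Rightarrow> 'a) \<Rightarrow> bool" where
  "topologically_transitive X T \<longleftrightarrow>
    (\<forall>D E. openin X D \<and> D \<noteq> {} \<and> openin X E \<and> E \<noteq> {} \<longrightarrow>
      (\<exists>k\<ge>1. (T ^^ k) ` D \<inter> E \<noteq> {}))"

definition holder_on :: "'a set \<Rightarrow> ('a \<Rightarrow> 'a \<Rightarrow> real) \<Rightarrow> real \<Rightarrow> ('a \<Rightarrow> real) \<Rightarrow> bool" where
  "holder_on S d \<theta> g \<longleftrightarrow> (\<exists>C. \<forall>x\<in>S. \<forall>y\<in>S. \<bar>g x - g y\<bar> \<le> C * d x y powr \<theta>)"

definition borel_of_topology :: "'a topology \<Rightarrow> 'a measure" where
  "borel_of_topology X = sigma (topspace X) {U. openin X U}"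

definition holonomic ::
    "nat \<Rightarrow> (nat \<Rightarrow> nat \<Rightarrow> nat) \<Rightarrow> real \<Rightarrow> (symseq \<times> symseq) measure set" where
  "holonomic r M lam = {\<mu>. prob_space \<mu> \<and> sets \<mu> = sets (borel_of_topology (hat_topology r M lam)) \<and>
    (\<forall>f. continuous_map (shift_topology r M lam) euclideanreal f \<longrightarrow>
      (\<integral>p. f (tau p) \<partial>\<mu>) = (\<integral>p. f (snd p) \<partial>\<mu>))}"

definition beta ::
    "nat \<Rightarrow> (nat \<Rightarrow> nat \<Rightarrow> nat) \<Rightarrow> real \<Rightarrow> (symseq \<times> symseq \<Rightarrow> real) \<Rightarrow> real" where
  "beta r M lam A = (GREATEST b. \<exists>\<mu>\<in>holonomic r M lam. b = (\<integral>p. A p \<partial>\<mu>))"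

text \<open>The minimum over the fibre is spelled out as an attained lower bound.\<close>

definition calibrated_subaction ::
    "nat \<Rightarrow> (nat \<Rightarrow> nat \<Rightarrow> nat) \<Rightarrow> real \<Rightarrow> (symseq \<times> symseq \<Rightarrow> real) \<Rightarrow> (symseq \<Rightarrow> real) \<Rightarrow> bool" where
  "calibrated_subaction r M lam A u \<longleftrightarrow>
    continuous_map (shift_topology r M lam) euclideanreal u \<and>
    (\<forall>x\<in>shift_space r M.
      (\<exists>y\<in>dual_fibre r M x. u x = u (tau (y, x)) - A (y, x) + beta r M lam A) \<and>
      (\<forall>y\<in>dual_fibre r M x. u x \<le> u (tau (y, x)) - A (y, x) + beta r M lam A))"

text \<open>As in \<open>\<P>(x, x', \<epsilon>)\<close>, paths start at the second point and end near the first one.\<close>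

definition paths ::
    "nat \<Rightarrow> (nat \<Rightarrow> nat \<Rightarrow> nat) \<Rightarrow> real \<Rightarrow> symseq \<Rightarrow> symseq \<Rightarrow> real \<Rightarrow> (symseq \<times> symseq) list set" where
  "paths r M lam x x' \<epsilon> = {p. p \<noteq> [] \<and> set p \<subseteq> hat_space r M \<and> snd (p ! 0) = x' \<and>
    (\<forall>j. Suc j < length p \<longrightarrow> snd (p ! Suc j) = tau (p ! j)) \<and>
    seq_dist lam (tau (p ! (length p - 1))) x < \<epsilon>}"

definition path_sum ::
    "nat \<Rightarrow> (nat \<Rightarrow> nat \<Rightarrow> nat) \<Rightarrow> real \<Rightarrow> (symseq \<times> symseq \<Rightarrow> real) \<Rightarrow> (symseq \<times> symseq) list \<Rightarrow> real" where
  "path_sum r M lam A p = (\<Sum>j<length p. A (p ! j) - beta r M lam A)"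

definition nonwandering ::
    "nat \<Rightarrow> (nat \<Rightarrow> nat \<Rightarrow> nat) \<Rightarrow> real \<Rightarrow> (symseq \<times> symseq \<Rightarrow> real) \<Rightarrow> symseq set" where
  "nonwandering r M lam A =
    {x \<in> shift_space r M. \<forall>\<epsilon>>0. \<exists>p\<in>paths r M lam x x \<epsilon>. \<bar>path_sum r M lam A p\<bar> < \<epsilon>}"

definition mane_eps ::
    "nat \<Rightarrow> (nat \<Rightarrow> nat \<Rightarrow> nat) \<Rightarrow> real \<Rightarrow> (symseq \<times> symseq \<Rightarrow> real) \<Rightarrow> real \<Rightarrow> symseq \<Rightarrow> symseq \<Rightarrow> ereal" where
  "mane_eps r M lam A \<epsilon> x x' = (INF p\<in>paths r M lam x x' \<epsilon>. ereal (- path_sum r M lam A p))"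

definition mane_potential ::
    "nat \<Rightarrow> (nat \<Rightarrow> nat \<Rightarrow> nat) \<Rightarrow> real \<Rightarrow> (symseq \<times> symseq \<Rightarrow> real) \<Rightarrow> symseq \<Rightarrow> symseq \<Rightarrow> ereal" where
  "mane_potential r M lam A x x' = Lim (at_right 0) (\<lambda>\<epsilon>. mane_eps r M lam A \<epsilon> x x')"

end

theory Submission
  imports Defs
begin

text \<open>The coordinates \<open>y\<^sub>1, y\<^sub>2, \<dots>\<close> of a point \<open>(y, x)\<close> influence only the value of \<open>A\<close>, whereas the
dynamics uses \<open>y\<^sub>0\<close> alone: a path starting at \<open>x\<close> prepends a finite word to \<open>x\<close>. The paths are therefore
recorded as lists of points of the dual space, called walks. Prepending contracts distances by \<open>lam\<close>, so
the same walk can be started at every point with the same first symbol, its gain (the sum of \<open>A - b\<close>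
along the path) changes by at most a constant times \<open>d x z powr \<theta>\<close> (\<open>gain_distortion\<close>), and its
endpoint hardly depends on the starting point when the walk is long. Everything rests on these facts.

The first task is to understand \<open>\<beta>\<^sub>A\<close>. By transitivity the best gain of a walk of length \<open>n\<close> is, up to a
bounded error, independent of the starting point, hence almost additive in \<open>n\<close>, hence equal to
\<open>n * rate + O(1)\<close>. The negative of the upper limit of the best gain minus \<open>n * rate\<close> is a Hoelder
calibrated sub-action \<open>base\<close> for the constant \<open>rate\<close>. Integrating the sub-action inequality bounds every
holonomic integral by \<open>rate\<close>. Conversely, a weak limit of the empirical measures along almost optimal
walks is holonomic with integral \<open>rate\<close>. So \<open>\<beta>\<^sub>A = rate\<close> (\<open>beta_eq_rate\<close>). The weak limit comes from
Helly's theorem on the real line, after an embedding of the compact space by digit expansions.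

An orbit along which \<open>base\<close> is calibrated has a cluster point, and shadowing a return to a
neighbourhood of it shows that this point is non-wandering. The sub-action \<open>base\<close> also bounds the Mane
potential from below. At a non-wandering point there are loops of arbitrary length and
almost zero cost (\<open>long_loop\<close>). Appended to a path that comes near the point, they show that the
Mane potential is already determined by arbitrarily long walks (\<open>long_walk\<close>). For long walks the
endpoint hardly depends on the starting point, which makes \<open>S\<^sub>A(x, \<cdot>)\<close> finite and locally Hoelder with a
constant that does not depend on \<open>x\<close>. Together with the lower bounds on \<open>f\<close> and on the potential, this
makes the infimum finite and Hoelder. Splitting off the first
step of a path shows that \<open>S\<^sub>A(x, \<cdot>)\<close> satisfies the sub-action inequality and, up to an arbitrarily
small error, the calibration equation. Both pass to the infimum over \<open>x\<close>, and compactness of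
the fibres turns the approximate minimiser into an exact one. The last claim follows from \<open>S\<^sub>A(x, x) \<le> 0\<close> on the
non-wandering set.\<close>

section \<open>The cylinder topology of symbol sequences\<close>

definition cyl :: "nat \<Rightarrow> symseq \<Rightarrow> symseq set" where
  "cyl n x = {z. \<forall>j<n. z j = x j}"

lemma cyl_self [simp]: "x \<in> cyl n x"
  by (simp add: cyl_def)

lemma open_cyl: "open (cyl n x)"
proof -
  have "cyl n x = (\<Inter>j\<in>{..<n}. (\<lambda>z. z j) -` {x j})"
    by (auto simp: cyl_def)
  moreover have "open ((\<lambda>z::symseq. z j) -` {x j})" for j
    by (rule open_vimage) (simp_all add: discrete_topology_class.open_discrete)
  ultimately show ?thesis by (auto intro!: open_INT)
qed

lemma open_contains_cyl:
  assumes "open U" "x \<in> U"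
  shows "\<exists>n. cyl n x \<subseteq> U"
proof -
  have "openin (product_topology (\<lambda>i. euclidean) UNIV) U"
    using assms(1) by (simp add: euclidean_product_topology)
  from product_topology_open_contains_basis[OF this assms(2)] obtain X where
    X: "x \<in> PiE UNIV X" "finite {i::nat. X i \<noteq> (UNIV::nat set)}" "PiE UNIV X \<subseteq> U" by auto
  then obtain n where n: "{i. X i \<noteq> UNIV} \<subseteq> {..<n}"
    using finite_nat_bounded by blast
  have "cyl n x \<subseteq> PiE UNIV X"
  proof
    fix z assume z: "z \<in> cyl n x"
    have "z i \<in> X i" for i
      using X(1) n z by (cases "i < n") (auto simp: cyl_def PiE_def)
    then show "z \<in> PiE UNIV X" by auto
  qed
  with X(3) show ?thesis by blast
qed

lemma open_contains_cyl_prod: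
  assumes "open W" "p \<in> W"
  shows "\<exists>n. cyl n (fst p) \<times> cyl n (snd p) \<subseteq> W"
proof -
  obtain U V where UV: "open U" "open V" "p \<in> U \<times> V" "U \<times> V \<subseteq> W"
    using open_prod_elim[OF assms] by metis
  obtain m n where "cyl m (fst p) \<subseteq> U" "cyl n (snd p) \<subseteq> V"
    using open_contains_cyl UV by (metis mem_Times_iff)
  moreover have "cyl (max m n) z \<subseteq> cyl m z" "cyl (max m n) z \<subseteq> cyl n z" for z
    by (auto simp: cyl_def)
  ultimately show ?thesis using UV(4) by blast
qed

lemma seq_dist_le_power_iff:
  assumes "0 < lam" "lam < 1"
  shows "seq_dist lam x z \<le> lam ^ n \<longleftrightarrow> z \<in> cyl n x"
proof (cases "x = z")
  case True
  then show ?thesis using assms by (simp add: seq_dist_def)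
next
  case False
  then obtain i where i: "x i \<noteq> z i" by blast
  have "seq_dist lam x z \<le> lam ^ n \<longleftrightarrow> n \<le> (LEAST j. x j \<noteq> z j)"
    using False assms power_decreasing_iff[of lam] by (simp add: seq_dist_def)
  also have "\<dots> \<longleftrightarrow> (\<forall>j<n. x j = z j)"
  proof
    assume "n \<le> (LEAST j. x j \<noteq> z j)"
    then show "\<forall>j<n. x j = z j"
      by (metis (mono_tags, lifting) not_less_Least order_less_le_trans)
  next
    assume a: "\<forall>j<n. x j = z j"
    have "x (LEAST j. x j \<noteq> z j) \<noteq> z (LEAST j. x j \<noteq> z j)"
      by (rule LeastI[of "\<lambda>j. x j \<noteq> z j", OF i])
    with a show "n \<le> (LEAST j. x j \<noteq> z j)"
      by (meson not_le_imp_less)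
  qed
  finally show ?thesis by (auto simp: cyl_def)
qed

lemma seq_dist_le_1:
  assumes "0 < lam" "lam < 1"
  shows "seq_dist lam x z \<le> 1"
  using seq_dist_le_power_iff[OF assms, of x z 0] by (simp add: cyl_def)

lemma seq_dist_less_1_iff:
  assumes "0 < lam" "lam < 1"
  shows "seq_dist lam x z < 1 \<longleftrightarrow> x 0 = z 0"
proof -
  have "seq_dist lam x z < 1 \<longleftrightarrow> seq_dist lam x z \<le> lam ^ 1"
  proof
    assume "seq_dist lam x z < 1"
    then have "x = z \<or> (LEAST j. x j \<noteq> z j) \<noteq> 0"
      by (cases "(LEAST j. x j \<noteq> z j) = 0") (auto simp: seq_dist_def split: if_splits)
    then show "seq_dist lam x z \<le> lam ^ 1"
      using assms power_decreasing[of 1 "LEAST j. x j \<noteq> z j" lam]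
      by (auto simp: seq_dist_def)
  qed (use assms in auto)
  also have "\<dots> \<longleftrightarrow> x 0 = z 0"
    unfolding seq_dist_le_power_iff[OF assms] by (auto simp: cyl_def)
  finally show ?thesis .
qed

lemma seq_dist_case_nat:
  assumes "0 < lam" "lam < 1"
  shows "seq_dist lam (case_nat i x) (case_nat i z) = lam * seq_dist lam x z"
proof (cases "x = z")
  case True
  then show ?thesis by (simp add: seq_dist_def)
next
  case False
  then obtain k where k: "x k \<noteq> z k" by blast
  have ne: "case_nat i x \<noteq> case_nat i z"
    using k by (metis old.nat.simps(5))
  have "(LEAST j. case_nat i x j \<noteq> case_nat i z j) = Suc (LEAST j. case_nat i x (Suc j) \<noteq> case_nat i z (Suc j))"
    by (rule Least_Suc[where n = "Suc k"]) (use k in auto)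
  then show ?thesis using False ne by (simp add: seq_dist_def)
qed

lemma openin_top_of_setI:
  assumes "U \<subseteq> S" "\<And>x. x \<in> U \<Longrightarrow> \<exists>T. open T \<and> x \<in> T \<and> T \<inter> S \<subseteq> U"
  shows "openin (top_of_set S) U"
proof -
  let ?W = "\<Union>{T. open T \<and> T \<inter> S \<subseteq> U}"
  have "x \<in> ?W" if "x \<in> U" for x using assms(2)[OF that] by (elim exE) (intro UnionI, auto)
  then have "U = S \<inter> ?W" using assms(1) by auto
  moreover have "open ?W" by auto
  ultimately show ?thesis unfolding openin_open by (intro exI[of _ ?W]) simp
qed

lemma power_small:
  fixes lam :: real
  assumes "0 < lam" "lam < 1" "0 < e"
  obtains n where "lam ^ n < e"
  using assms real_arch_pow_inv by blast

text \<open>The closed ball of radius \<open>lam ^ n\<close> is the cylinder of length \<open>n\<close>, so the metric induces the product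
topology. This makes the compactness and the continuity of the type class topology available.\<close>

lemma shift_topology_eq:
  assumes "0 < lam" "lam < 1"
  shows "shift_topology r M lam = top_of_set (shift_space r M)"
proof -
  let ?S = "shift_space r M"
  interpret Metric_space ?S "seq_dist lam" by (rule Metric_space_seq_dist[OF assms])
  have "openin mtopology U \<longleftrightarrow> openin (top_of_set ?S) U" for U
  proof
    assume U: "openin mtopology U"
    have "\<exists>T. open T \<and> x \<in> T \<and> T \<inter> ?S \<subseteq> U" if xU: "x \<in> U" for x
    proof -
      obtain e where e: "e > 0" "mball x e \<subseteq> U"
        using U xU unfolding openin_mtopology by blast
      obtain n where n: "lam ^ n < e" using power_small[OF assms e(1)] .
      have "cyl n x \<inter> ?S \<subseteq> mball x e"
        using n U xU seq_dist_le_power_iff[OF assms, of x _ n] by (force simp: openin_mtopology)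
      then show ?thesis using e(2) open_cyl[of n x] by (intro exI[of _ "cyl n x"]) auto
    qed
    moreover have "U \<subseteq> ?S" using U unfolding openin_mtopology by blast
    ultimately show "openin (top_of_set ?S) U"
      using openin_top_of_setI[of U ?S] by blast
  next
    assume U: "openin (top_of_set ?S) U"
    then obtain T where T: "open T" "U = ?S \<inter> T" unfolding openin_open by blast
    have "\<exists>e>0. mball x e \<subseteq> U" if x: "x \<in> U" for x
    proof -
      obtain n where n: "cyl n x \<subseteq> T" using open_contains_cyl[of T x] T x by blast
      have "mball x (lam ^ n) \<subseteq> U"
      proof
        fix q assume "q \<in> mball x (lam ^ n)"
        then have "q \<in> ?S" "seq_dist lam x q \<le> lam ^ n" by (auto simp: in_mball)
        then show "q \<in> U" using n T(2) seq_dist_le_power_iff[OF assms] by blast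
      qed
      then show ?thesis using assms by (intro exI[of _ "lam ^ n"]) auto
    qed
    then show "openin mtopology U" unfolding openin_mtopology using T(2) by blast
  qed
  then show ?thesis unfolding shift_topology_def topology_eq by blast
qed

lemma hat_dist_le_power_iff:
  assumes "0 < lam" "lam < 1"
  shows "hat_dist lam p q \<le> lam ^ n \<longleftrightarrow> q \<in> cyl n (fst p) \<times> cyl n (snd p)"
  using seq_dist_le_power_iff[OF assms] by (auto simp: hat_dist_def mem_Times_iff)

lemma hat_topology_eq:
  assumes "0 < lam" "lam < 1"
  shows "hat_topology r M lam = top_of_set (hat_space r M)"
proof -
  let ?S = "hat_space r M"
  interpret Metric_space ?S "hat_dist lam" by (rule Metric_space_hat_dist[OF assms])
  have "openin mtopology U \<longleftrightarrow> openin (top_of_set ?S) U" for U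
  proof
    assume U: "openin mtopology U"
    have "\<exists>T. open T \<and> x \<in> T \<and> T \<inter> ?S \<subseteq> U" if xU: "x \<in> U" for x
    proof -
      obtain e where e: "e > 0" "mball x e \<subseteq> U"
        using U xU unfolding openin_mtopology by blast
      obtain n where n: "lam ^ n < e" using power_small[OF assms e(1)] .
      let ?T = "cyl n (fst x) \<times> cyl n (snd x)"
      have "x \<in> ?S" using U xU unfolding openin_mtopology by blast
      then have "?T \<inter> ?S \<subseteq> mball x e"
        using n hat_dist_le_power_iff[OF assms, of x _ n] by (force simp: in_mball)
      then show ?thesis using e(2) open_cyl
        by (intro exI[of _ ?T]) (auto intro!: open_Times simp: mem_Times_iff)
    qed
    moreover have "U \<subseteq> ?S" using U unfolding openin_mtopology by blast
    ultimately show "openin (top_of_set ?S) U"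
      using openin_top_of_setI[of U ?S] by blast
  next
    assume U: "openin (top_of_set ?S) U"
    then obtain T where T: "open T" "U = ?S \<inter> T" unfolding openin_open by blast
    have "\<exists>e>0. mball x e \<subseteq> U" if x: "x \<in> U" for x
    proof -
      obtain n where n: "cyl n (fst x) \<times> cyl n (snd x) \<subseteq> T"
        using open_contains_cyl_prod[of T x] T x by blast
      have "mball x (lam ^ n) \<subseteq> U"
      proof
        fix q assume "q \<in> mball x (lam ^ n)"
        then have "q \<in> ?S" "hat_dist lam x q \<le> lam ^ n" by (auto simp: in_mball)
        then show "q \<in> U" using n T(2) hat_dist_le_power_iff[OF assms] by blast
      qed
      then show ?thesis using assms by (intro exI[of _ "lam ^ n"]) auto
    qed
    then show "openin mtopology U" unfolding openin_mtopology using T(2) by blast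
  qed
  then show ?thesis unfolding hat_topology_def topology_eq by blast
qed

text \<open>Tychonoff's theorem for a finite alphabet.\<close>

lemma compact_bounded_sequences: "compact {x :: symseq. \<forall>j. x j \<in> {1..r}}"
proof -
  have "compactin (product_topology (\<lambda>i. euclidean) UNIV) (PiE UNIV (\<lambda>_::nat. {1..r}))"
    by (subst compactin_PiE) (auto simp: finite_imp_compact)
  moreover have "PiE UNIV (\<lambda>_::nat. {1..r}) = {x. \<forall>j. x j \<in> {1..r}}"
    by (auto simp: PiE_def Pi_def)
  ultimately show ?thesis by (simp add: euclidean_product_topology)
qed

lemma closed_nat_condition:
  fixes f :: "'a :: topological_space \<Rightarrow> nat"
  assumes "continuous_on UNIV f"
  shows "closed {p. P (f p)}"
proof -
  have "closed (f -` {a. P a})"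
    using assms by (intro closed_vimage) (simp_all add: closed_def discrete_topology_class.open_discrete)
  then show ?thesis by (simp add: vimage_def)
qed

text \<open>The intersection over the values \<open>a\<close> of the first coordinate reduces a relation between two
symbols to conditions on single symbols.\<close>

lemma closed_transition:
  fixes f g :: "'a :: topological_space \<Rightarrow> nat"
  assumes "continuous_on UNIV f" "continuous_on UNIV g"
  shows "closed {p. P (f p) (g p)}"
proof -
  have "{p. P (f p) (g p)} = (\<Inter>a. {p. f p = a \<longrightarrow> P a (g p)})" by auto
  moreover have "closed {p. f p = a \<longrightarrow> P a (g p)}" for a
    using closed_Un[OF closed_nat_condition[OF assms(1), of "\<lambda>b. b \<noteq> a"]
        closed_nat_condition[OF assms(2), of "P a"]]
    by (rule back_subst[of closed]) auto
  ultimately show ?thesis by auto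
qed

lemma continuous_on_coordinate: "continuous_on UNIV (\<lambda>x::symseq. x j)"
  by simp

lemma compact_shift_space: "compact (shift_space r M)"
proof -
  have eq: "shift_space r M = {x. \<forall>j. x j \<in> {1..r}} \<inter> (\<Inter>j. {x. M (x j) (x (Suc j)) = 1})"
    by (auto simp: shift_space_def)
  have "closed {x::symseq. M (x j) (x (Suc j)) = 1}" for j
    using closed_transition[OF continuous_on_coordinate[of "j"] continuous_on_coordinate[of "Suc j"],
        of "\<lambda>a b. M a b = 1"] by simp
  then have "closed (\<Inter>j. {x. M (x j) (x (Suc j)) = 1})" by auto
  from compact_Int_closed[OF compact_bounded_sequences this] show ?thesis unfolding eq .
qed

lemma compact_dual_space: "compact (dual_space r M)"
proof -
  have eq: "dual_space r M = {x. \<forall>j. x j \<in> {1..r}} \<inter> (\<Inter>j. {x. M (x (Suc j)) (x j) = 1})"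
    by (auto simp: dual_space_def)
  have "closed {x::symseq. M (x (Suc j)) (x j) = 1}" for j
    using closed_transition[OF continuous_on_coordinate[of "Suc j"] continuous_on_coordinate[of "j"],
        of "\<lambda>a b. M a b = 1"] by simp
  then have "closed (\<Inter>j. {x. M (x (Suc j)) (x j) = 1})" by auto
  from compact_Int_closed[OF compact_bounded_sequences this] show ?thesis unfolding eq .
qed

lemma compact_hat_space: "compact (hat_space r M)"
proof -
  have eq: "hat_space r M = (dual_space r M \<times> shift_space r M) \<inter> {p. M (fst p 0) (snd p 0) = 1}"
    by (auto simp: hat_space_def)
  have "continuous_on UNIV (\<lambda>p::symseq \<times> symseq. fst p 0)"
    by (rule continuous_on_product_then_coordinatewise[OF continuous_on_fst[OF continuous_on_id]])
  moreover have "continuous_on UNIV (\<lambda>p::symseq \<times> symseq. snd p 0)"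
    by (rule continuous_on_product_then_coordinatewise[OF continuous_on_snd[OF continuous_on_id]])
  ultimately have cont: "continuous_on UNIV (\<lambda>p::symseq \<times> symseq. fst p 0)"
    "continuous_on UNIV (\<lambda>p::symseq \<times> symseq. snd p 0)" by simp_all
  from closed_transition[OF cont, of "\<lambda>a b. M a b = 1"]
  have "closed {p::symseq \<times> symseq. M (fst p 0) (snd p 0) = 1}" by simp
  from compact_Int_closed[OF compact_Times[OF compact_dual_space compact_shift_space] this]
  show ?thesis unfolding eq .
qed

lemma compact_dual_fibre:
  assumes "x \<in> shift_space r M"
  shows "compact (dual_fibre r M x)"
proof -
  have eq: "dual_fibre r M x = dual_space r M \<inter> {y. M (y 0) (x 0) = 1}"
    using assms by (auto simp: dual_fibre_def hat_space_def)
  have "closed {y::symseq. M (y 0) (x 0) = 1}"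
    using closed_nat_condition[OF continuous_on_coordinate[of 0], of "\<lambda>a. M a (x 0) = 1"] by simp
  from compact_Int_closed[OF compact_dual_space this] show ?thesis unfolding eq .
qed

text \<open>Stated for a metric given through its balls \<open>B n x\<close> of radius \<open>lam ^ n\<close>, so that it serves the one-sided
space and the space of pairs alike.\<close>

lemma holder_continuous_on:
  assumes d: "\<And>x n z. d x z \<le> lam ^ n \<longleftrightarrow> z \<in> B n x"
    and B: "\<And>x n. open (B n x)" 
    and lam: "0 < lam" "lam < 1" and "0 < \<theta>" and nonneg: "\<And>x z. 0 \<le> d x z"
    and h: "holder_on S d \<theta> g" and self: "\<And>n x. x \<in> B n x"
  shows "continuous_on S g"
  unfolding continuous_on_topological
proof (intro ballI allI impI)
  fix x T assume x: "x \<in> S" "open T" "g x \<in> T"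
  then obtain e where e: "e > 0" "ball (g x) e \<subseteq> T" using open_contains_ball by blast
  obtain C where C: "\<And>x y. x \<in> S \<Longrightarrow> y \<in> S \<Longrightarrow> \<bar>g x - g y\<bar> \<le> C * d x y powr \<theta>"
    using h unfolding holder_on_def by blast
  define C' where "C' = max C 1"
  have C': "\<And>x y. x \<in> S \<Longrightarrow> y \<in> S \<Longrightarrow> \<bar>g x - g y\<bar> \<le> C' * d x y powr \<theta>" "C' > 0"
    using C unfolding C'_def by (meson max.cobounded1 mult_right_mono order_trans powr_ge_zero) simp
  obtain n where n: "lam ^ n < (e / C') powr (1 / \<theta>)"
    using power_small[OF lam, of "(e / C') powr (1 / \<theta>)"] e(1) C'(2) by auto
  have "g z \<in> T" if "z \<in> S" "z \<in> B n x" for z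
  proof -
    have "d x z < (e / C') powr (1 / \<theta>)" using d that n by (meson le_less_trans)
    then have "d x z powr \<theta> < ((e / C') powr (1 / \<theta>)) powr \<theta>"
      using nonneg \<open>0 < \<theta>\<close> by (intro powr_less_mono2) auto
    also have "\<dots> = e / C'" using \<open>0 < \<theta>\<close> e(1) C'(2) by (simp add: powr_powr)
    finally have "C' * d x z powr \<theta> < e" using C'(2) by (simp add: field_simps)
    then have "\<bar>g x - g z\<bar> < e" using C'(1)[OF x(1) that(1)] by linarith
    then show ?thesis using e(2) by (auto simp: dist_real_def)
  qed
  then show "\<exists>U. open U \<and> x \<in> U \<and> (\<forall>y\<in>S. y \<in> U \<longrightarrow> g y \<in> T)"
    using B[of n x] self[of x n] by (intro exI[of _ "B n x"]) simp
qed

lemma continuous_on_tau: "continuous_on S tau"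
proof (rule continuous_on_coordinatewise_then_product)
  fix i
  have fst: "continuous_on S (\<lambda>p::symseq \<times> symseq. fst p 0)"
    by (rule continuous_on_product_then_coordinatewise[OF continuous_on_fst[OF continuous_on_id]])
  have snd: "continuous_on S (\<lambda>p::symseq \<times> symseq. snd p j)" for j
    by (rule continuous_on_product_then_coordinatewise[OF continuous_on_snd[OF continuous_on_id]])
  show "continuous_on S (\<lambda>p. tau p i)"
  proof (cases i)
    case 0
    then show ?thesis using fst by (simp add: tau_def case_prod_unfold)
  next
    case (Suc j)
    then show ?thesis using snd by (simp add: tau_def case_prod_unfold)
  qed
qed

text \<open>A cluster point of the filter of tails of the sequence is visited infinitely often.\<close>

lemma compact_cluster_point:
  assumes "compact S" "\<And>n. s n \<in> S"
  shows "\<exists>x\<in>S. \<forall>U. open U \<longrightarrow> x \<in> U \<longrightarrow> (\<exists>\<^sub>F n in sequentially. s n \<in> U)"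
proof -
  let ?F = "filtermap s sequentially"
  have "?F \<noteq> bot" by (simp add: filtermap_bot_iff)
  moreover have "eventually (\<lambda>x. x \<in> S) ?F" using assms(2) by (simp add: eventually_filtermap)
  ultimately obtain x where x: "x \<in> S" "inf (nhds x) ?F \<noteq> bot"
    using assms(1) unfolding compact_filter by blast
  have "\<exists>\<^sub>F n in sequentially. s n \<in> U" if U: "open U" "x \<in> U" for U
  proof (rule ccontr)
    assume "\<not> (\<exists>\<^sub>F n in sequentially. s n \<in> U)"
    then have "eventually (\<lambda>z. z \<notin> U) ?F" by (simp add: eventually_filtermap not_frequently)
    moreover have "eventually (\<lambda>z. z \<in> U) (nhds x)" using eventually_nhds U by blast
    ultimately have "eventually (\<lambda>z. False) (inf (nhds x) ?F)"
      unfolding eventually_inf by blast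
    then show False using x(2) by (simp add: eventually_False)
  qed
  then show ?thesis using x(1) by blast
qed

section \<open>Weak limits of measures on a compact set\<close>

lemma space_borel_of_topology [simp]: "space (borel_of_topology X) = topspace X"
  unfolding borel_of_topology_def by (rule space_measure_of) (auto dest: openin_subset)

lemma continuous_map_borel_measurable:
  fixes g :: "'a \<Rightarrow> real"
  assumes "continuous_map X euclidean g"
  shows "g \<in> borel_measurable (borel_of_topology X)"
proof (rule borel_measurableI)
  fix T :: "real set" assume "open T"
  then have "openin X {x \<in> topspace X. g x \<in> T}"
    using assms by (simp add: continuous_map_def)
  moreover have "g -` T \<inter> topspace X = {x \<in> topspace X. g x \<in> T}" by auto
  ultimately show "g -` T \<inter> space (borel_of_topology X) \<in> sets (borel_of_topology X)"
    unfolding borel_of_topology_def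
    by (subst sets_measure_of) (auto dest: openin_subset simp: borel_of_topology_def[symmetric])
qed

text \<open>A version of Prokhorov's theorem. The measures are pushed to the real line by the embedding \<open>e\<close>, where they are
tight because \<open>e ` K\<close> is bounded, so that Helly's theorem yields a weak limit. The limit is pulled back by
the inverse of \<open>e\<close>; a test function on \<open>K\<close> becomes a test function on the line by Tietze's theorem.\<close>

theorem pmfs_on_compact_subconverge:
  fixes e :: "'a :: topological_space \<Rightarrow> real" and P :: "nat \<Rightarrow> 'a pmf"
  assumes K: "compact K" and e: "continuous_on K e" "inj_on e K"
    and P: "\<And>n. set_pmf (P n) \<subseteq> K"
  shows "\<exists>s \<mu>. strict_mono s \<and> prob_space \<mu> \<and> sets \<mu> = sets (borel_of_topology (top_of_set K)) \<and>
    (\<forall>g :: 'a \<Rightarrow> real. continuous_on K g \<longrightarrow>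
      (\<lambda>n. measure_pmf.expectation (P (s n)) g) \<longlonglongrightarrow> integral\<^sup>L \<mu> g)"
proof -
  define Q where "Q n = distr (measure_pmf (P n)) borel e" for n
  have rd: "real_distribution (Q n)" for n
    unfolding Q_def by (rule prob_space.real_distribution_distr[OF prob_space_measure_pmf]) simp
  have "compact (e ` K)" using compact_continuous_image[OF e(1) K] .
  then have cl: "closed (e ` K)" by (rule compact_imp_closed)
  obtain B where B: "\<And>x. x \<in> K \<Longrightarrow> \<bar>e x\<bar> \<le> B" and "B \<ge> 0"
    using \<open>compact (e ` K)\<close> compact_imp_bounded[of "e ` K"] unfolding bounded_pos
    by (auto intro: less_imp_le)
  have AE_P: "AE x in measure_pmf (P n). x \<in> K" for n
    using P[of n] by (auto simp: AE_measure_pmf_iff)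
  have "measure (Q n) {- B - 1<..B} = 1" for n
  proof -
    have "measure (Q n) {- B - 1<..B} = measure (measure_pmf (P n)) (e -` {- B - 1<..B})"
      unfolding Q_def by (subst measure_distr) auto
    also have "\<dots> = 1"
    proof (subst measure_pmf.prob_eq_1)
      show "AE x in measure_pmf (P n). x \<in> e -` {- B - 1<..B}"
        using AE_P[of n] by eventually_elim (use B in \<open>force\<close>)
    qed simp
    finally show ?thesis .
  qed
  then have "tight Q"
    unfolding tight_def
  proof (intro conjI allI impI rd)
    fix \<epsilon> :: real assume "\<epsilon> > 0"
    then show "\<exists>a b. a < b \<and> (\<forall>n. 1 - \<epsilon> < measure (Q n) {a<..b})"
      using \<open>B \<ge> 0\<close> \<open>\<And>n. measure (Q n) {- B - 1<..B} = 1\<close>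
      by (intro exI[of _ "- B - 1"] exI[of _ B]) simp
  qed
  from tight_imp_convergent_subsubsequence[OF this strict_mono_id] obtain s M where
    s: "strict_mono (s :: nat \<Rightarrow> nat)" and M: "real_distribution M" and w: "weak_conv_m (\<lambda>n. Q (s n)) M"
    by (auto simp: o_def)
  interpret M: real_distribution M by (rule M)
  have conv: "(\<lambda>n. measure_pmf.expectation (P (s n)) (\<lambda>x. G (e x))) \<longlonglongrightarrow> integral\<^sup>L M G"
    if G: "\<And>t. isCont G t" "\<And>t. \<bar>G t\<bar> \<le> b" for G :: "real \<Rightarrow> real" and b
  proof -
    have m: "G \<in> borel_measurable borel"
      using G(1) by (intro borel_measurable_continuous_onI) (simp add: continuous_on_eq_continuous_at)
    have "(\<lambda>n. integral\<^sup>L (Q (s n)) G) \<longlonglongrightarrow> integral\<^sup>L M G"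
      by (rule weak_conv_imp_integral_bdd_continuous_conv[OF rd M w]) (use G in auto)
    moreover have "integral\<^sup>L (Q n) G = measure_pmf.expectation (P n) (\<lambda>x. G (e x))" for n
      unfolding Q_def by (rule integral_distr) (use m in simp_all)
    ultimately show ?thesis by simp
  qed
  (* The limit lives on e ` K, because it integrates the truncated distance to that set to zero. *)
  have "K \<noteq> {}" using P[of 0] set_pmf_not_empty[of "P 0"] by auto
  then have ne: "e ` K \<noteq> {}" by simp
  define G0 where "G0 t = min 1 (infdist t (e ` K))" for t
  have G0: "isCont G0 t" "\<bar>G0 t\<bar> \<le> 1" "G0 t \<ge> 0" for t
    unfolding G0_def by (auto intro!: continuous_intros simp: infdist_nonneg)
  have G0m: "G0 \<in> borel_measurable borel"
    using G0(1) by (intro borel_measurable_continuous_onI) (simp add: continuous_on_eq_continuous_at)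
  have "measure_pmf.expectation (P n) (\<lambda>x. G0 (e x)) = 0" for n
  proof -
    have "measure_pmf.expectation (P n) (\<lambda>x. G0 (e x)) = measure_pmf.expectation (P n) (\<lambda>x. 0)"
      by (rule integral_cong_AE) (use AE_P[of n] in \<open>auto simp: G0_def\<close>)
    then show ?thesis by simp
  qed
  then have "integral\<^sup>L M G0 = 0"
    using conv[OF G0(1,2)] by (simp add: LIMSEQ_const_iff)
  moreover have "integrable M G0"
    by (rule M.integrable_const_bound[where B = 1]) (use G0 G0m in auto)
  ultimately have "AE t in M. G0 t = 0"
    using integral_nonneg_eq_0_iff_AE[of M G0] G0(3) by auto
  then have AE_M: "AE t in M. t \<in> e ` K"
  proof eventually_elim
    case (elim t)
    then have "infdist t (e ` K) = 0" by (auto simp: G0_def min_def split: if_splits)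
    then show ?case using in_closed_iff_infdist_zero[OF cl ne] by blast
  qed
  (* The default value c makes h map the whole line into K. *)
  obtain c where c: "c \<in> K" using \<open>K \<noteq> {}\<close> by blast
  define h where "h t = (if t \<in> e ` K then the_inv_into K e t else c)" for t
  have he: "h (e x) = x" if "x \<in> K" for x
    using that e(2) by (simp add: h_def the_inv_into_f_f)
  have hK: "h t \<in> K" for t
    using c he by (cases "t \<in> e ` K") (auto simp: h_def)
  let ?N = "borel_of_topology (top_of_set K)"
  have hm: "h \<in> measurable M ?N"
    unfolding borel_of_topology_def
  proof (rule measurable_measure_of)
    fix U assume "U \<in> {U. openin (top_of_set K) U}"
    then obtain T where T: "open T" "U = K \<inter> T" by (auto simp: openin_open)
    have "compact (K - T)" using K T(1) by (rule compact_diff)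
    then have "compact (e ` (K - T))"
      using e(1) by (intro compact_continuous_image) (auto intro: continuous_on_subset)
    then have cl': "closed (e ` (K - T))" by (rule compact_imp_closed)
    have "h -` U = (e ` K - e ` (K - T)) \<union> (if c \<in> T then - (e ` K) else {})"
      (is "?L = ?R")
    proof (rule set_eqI)
      fix t
      show "t \<in> ?L \<longleftrightarrow> t \<in> ?R"
      proof (cases "t \<in> e ` K")
        case True
        then obtain x where x: "x \<in> K" "t = e x" by blast
        then have "t \<in> e ` (K - T) \<longleftrightarrow> x \<notin> T"
          using inj_on_image_mem_iff[OF e(2), of x "K - T"] by auto
        then show ?thesis using x he T(2) by auto
      next
        case False
        then show ?thesis using c T(2) by (auto simp: h_def)
      qed
    qed
    then show "h -` U \<inter> space M \<in> sets M" using cl cl' by auto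
  qed (use hK in \<open>auto dest: openin_imp_subset\<close>)
  define \<mu> where "\<mu> = distr M ?N h"
  have "(\<lambda>n. measure_pmf.expectation (P (s n)) g) \<longlonglongrightarrow> integral\<^sup>L \<mu> g"
    if g: "continuous_on K g" for g :: "'a \<Rightarrow> real"
  proof -
    have gm: "g \<in> borel_measurable ?N"
      using g by (intro continuous_map_borel_measurable) simp
    obtain b where b: "\<And>x. x \<in> K \<Longrightarrow> \<bar>g x\<bar> \<le> b" and "b \<ge> 0"
      using compact_imp_bounded[OF compact_continuous_image[OF g K]] unfolding bounded_pos
      by (auto intro: less_imp_le)
    have "continuous_on (e ` K) h"
      by (rule continuous_on_inv[OF e(1) K]) (use he in auto)
    then have "continuous_on (e ` K) (\<lambda>t. g (h t))"
      by (rule continuous_on_compose2[OF g]) (use hK in auto)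
    moreover have "closedin (top_of_set UNIV) (e ` K)" using cl by simp
    moreover have "norm (g (h t)) \<le> b" for t using b hK by simp
    ultimately obtain G where G: "continuous_on UNIV G" "\<And>t. t \<in> e ` K \<Longrightarrow> G t = g (h t)"
      "\<And>t. \<bar>G t\<bar> \<le> b"
      using Tietze[of "e ` K" "\<lambda>t. g (h t)" UNIV b] \<open>b \<ge> 0\<close> by (metis UNIV_I real_norm_def)
    have "(\<lambda>n. measure_pmf.expectation (P (s n)) (\<lambda>x. G (e x))) \<longlonglongrightarrow> integral\<^sup>L M G"
      by (rule conv[OF _ G(3)]) (use G(1) in \<open>simp add: continuous_on_eq_continuous_at\<close>)
    moreover have "measure_pmf.expectation (P n) (\<lambda>x. G (e x)) = measure_pmf.expectation (P n) g" for n
      by (rule integral_cong_AE) (use AE_P[of n] in \<open>auto simp: G(2) he\<close>)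
    moreover have "integral\<^sup>L M G = integral\<^sup>L \<mu> g"
    proof -
      have "G \<in> borel_measurable borel" using G(1) by (rule borel_measurable_continuous_onI)
      moreover have "(\<lambda>t. g (h t)) \<in> borel_measurable M" using measurable_compose[OF hm gm] .
      ultimately have "integral\<^sup>L M G = integral\<^sup>L M (\<lambda>t. g (h t))"
        by (intro integral_cong_AE) (use AE_M in \<open>auto simp: G(2) elim!: eventually_mono\<close>)
      also have "\<dots> = integral\<^sup>L \<mu> g"
        unfolding \<mu>_def by (rule integral_distr[symmetric, OF hm gm])
      finally show ?thesis .
    qed
    ultimately show ?thesis by simp
  qed
  moreover have "prob_space \<mu>" unfolding \<mu>_def by (rule M.prob_space_distr[OF hm])
  ultimately show ?thesis using s by (intro exI[of _ s] exI[of _ \<mu>]) (simp add: \<mu>_def)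
qed

section \<open>Coding pairs of sequences by real numbers\<close>

definition expansion :: "nat \<Rightarrow> (nat \<Rightarrow> nat) \<Rightarrow> real" where
  "expansion R d = (\<Sum>j. real (d j) * (1 / (R + 2)) ^ j)"

lemma summable_expansion:
  fixes d :: "nat \<Rightarrow> real"
  assumes "\<And>j. \<bar>d j\<bar> \<le> R"
  shows "summable (\<lambda>j. d j * (1 / (real R + 2)) ^ j)"
proof (rule summable_comparison_test')
  show "summable (\<lambda>j. real R * (1 / (real R + 2)) ^ j)"
    by (intro summable_mult summable_geometric) (simp add: field_simps)
  show "norm (d j * (1 / (real R + 2)) ^ j) \<le> real R * (1 / (real R + 2)) ^ j" if "j \<ge> 0" for j
    unfolding norm_mult using assms[of j] by (intro mult_mono) (auto simp: norm_power)
qed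

text \<open>At the first difference the larger digit wins, because in base \<open>R + 2\<close> the remaining digits, which are at
most \<open>R\<close>, contribute less than one unit of the deciding place.\<close>

lemma expansion_less:
  assumes "\<And>j. d j \<le> R" "\<And>j. d' j \<le> R" "\<And>j. j < n \<Longrightarrow> d j = d' j" "d n < d' n"
  shows "expansion R d < expansion R d'"
proof -
  let ?c = "1 / (real R + 2)"
  let ?a = "\<lambda>j. real (d' j) - real (d j)"
  have le: "\<bar>?a j\<bar> \<le> R" for j using assms(1)[of j] assms(2)[of j] by linarith
  have sm: "summable (\<lambda>j. ?a j * ?c ^ j)" by (rule summable_expansion[OF le])
  have geo: "(\<lambda>j. - (real R * ?c ^ Suc n) * ?c ^ j) sums (- (real R * ?c ^ Suc n) * (1 / (1 - ?c)))"
    by (intro sums_mult geometric_sums) (simp add: field_simps)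
  have "- ((real R * ?c ^ Suc n) * (1 / (1 - ?c))) \<le> (\<Sum>j. ?a (j + Suc n) * ?c ^ (j + Suc n))"
  proof (subst minus_mult_left, subst sums_unique[OF geo])
    show "(\<Sum>j. - (real R * ?c ^ Suc n) * ?c ^ j) \<le> (\<Sum>j. ?a (j + Suc n) * ?c ^ (j + Suc n))"
  proof (rule suminf_le)
    show "- (real R * ?c ^ Suc n) * ?c ^ j \<le> ?a (j + Suc n) * ?c ^ (j + Suc n)" for j
    proof -
      have "- real R * ?c ^ (j + Suc n) \<le> ?a (j + Suc n) * ?c ^ (j + Suc n)"
        by (rule mult_right_mono) (use le[of "j + Suc n"] in auto)
      then show ?thesis by (simp add: power_add mult_ac)
    qed
  qed (use sums_summable[OF geo] summable_ignore_initial_segment[OF sm, of "Suc n"] in auto)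
  qed
  moreover have "(\<Sum>j<Suc n. ?a j * ?c ^ j) = ?a n * ?c ^ n"
    using assms(3) by simp
  moreover have "?a n * ?c ^ n \<ge> 1 * ?c ^ n"
    by (rule mult_right_mono) (use assms(4) in auto)
  moreover have "1 * ?c ^ n > (real R * ?c ^ Suc n) * (1 / (1 - ?c))"
  proof -
    have "(real R * ?c ^ Suc n) * (1 / (1 - ?c)) = ?c ^ n * (real R / (real R + 1))"
    proof -
      have "?c * (1 / (1 - ?c)) = 1 / (real R + 1)" by (simp add: field_simps)
      moreover have "(real R * ?c ^ Suc n) * (1 / (1 - ?c)) = ?c ^ n * (real R * (?c * (1 / (1 - ?c))))"
        by (simp only: power_Suc mult_ac)
      ultimately show ?thesis by simp
    qed
    also have "\<dots> < ?c ^ n * 1" by (intro mult_strict_left_mono) auto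
    finally show ?thesis by simp
  qed
  moreover have "(\<Sum>j. ?a j * ?c ^ j) = (\<Sum>j. ?a (j + Suc n) * ?c ^ (j + Suc n)) + (\<Sum>j<Suc n. ?a j * ?c ^ j)"
    by (rule suminf_split_initial_segment[OF sm])
  ultimately have "(\<Sum>j. ?a j * ?c ^ j) > 0" by linarith
  moreover have "(\<Sum>j. ?a j * ?c ^ j) = expansion R d' - expansion R d"
    unfolding expansion_def left_diff_distrib
    by (rule suminf_diff[symmetric]; rule summable_expansion) (use assms in auto)
  ultimately show ?thesis by simp
qed

lemma expansion_inject:
  assumes "\<And>j. d j \<le> R" "\<And>j. d' j \<le> R" "expansion R d = expansion R d'"
  shows "d = d'"
proof (rule ccontr)
  assume "d \<noteq> d'"
  then obtain k where k: "d k \<noteq> d' k" by blast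
  define n where "n = (LEAST j. d j \<noteq> d' j)"
  have "d n \<noteq> d' n" unfolding n_def by (rule LeastI, rule k)
  moreover have eq: "d j = d' j" if "j < n" for j
    using not_less_Least[of j "\<lambda>j. d j \<noteq> d' j"] that unfolding n_def by blast
  ultimately show False
    using expansion_less[of d R d' n] expansion_less[of d' R d n] assms by (metis less_irrefl nat_neq_iff)
qed

text \<open>One digit holds both symbols at a position. Since \<open>r + 1\<close> exceeds every symbol, both can be recovered
from the digit.\<close>

definition hat_code :: "nat \<Rightarrow> symseq \<times> symseq \<Rightarrow> real" where
  "hat_code r p = expansion (r + (r + 1) * r) (\<lambda>j. fst p j + (r + 1) * snd p j)"

lemma hat_space_le:
  assumes "p \<in> hat_space r M"
  shows "fst p j \<le> r" "snd p j \<le> r"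
  using assms by (auto simp: hat_space_def dual_space_def shift_space_def)

lemma hat_digit_le:
  assumes "p \<in> hat_space r M"
  shows "fst p j + (r + 1) * snd p j \<le> r + (r + 1) * r"
  using hat_space_le[OF assms] by (intro add_mono mult_left_mono) auto

lemma inj_on_hat_code: "inj_on (hat_code r) (hat_space r M)"
proof (rule inj_onI)
  fix p q assume pq: "p \<in> hat_space r M" "q \<in> hat_space r M" "hat_code r p = hat_code r q"
  have "(\<lambda>j. fst p j + (r + 1) * snd p j) = (\<lambda>j. fst q j + (r + 1) * snd q j)"
    by (rule expansion_inject[OF hat_digit_le[OF pq(1)] hat_digit_le[OF pq(2)]])
      (use pq(3) in \<open>simp add: hat_code_def\<close>)
  then have eq: "fst p j + (r + 1) * snd p j = fst q j + (r + 1) * snd q j" for j by metis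
  have "fst p j = fst q j \<and> snd p j = snd q j" for j
  proof -
    have less: "fst p j < r + 1" "fst q j < r + 1"
      using hat_space_le[OF pq(1), of j] hat_space_le[OF pq(2), of j] by auto
    have "fst p j = (fst p j + (r + 1) * snd p j) mod (r + 1)"
      by (simp only: mod_mult_self2 mod_less[OF less(1)])
    also have "\<dots> = fst q j"
      by (simp only: eq mod_mult_self2 mod_less[OF less(2)])
    finally have "fst p j = fst q j" .
    moreover from this have "(r + 1) * snd p j = (r + 1) * snd q j" using eq[of j] by linarith
    then have "snd p j = snd q j" by (simp only: mult_cancel1) simp
    ultimately show ?thesis ..
  qed
  then show "p = q" by (auto simp: prod_eq_iff)
qed

lemma continuous_on_hat_code: "continuous_on (hat_space r M) (hat_code r)"
proof -
  let ?R = "r + (r + 1) * r"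
  let ?c = "1 / (real ?R + 2)"
  let ?f = "\<lambda>j (p::symseq \<times> symseq). real (fst p j + (r + 1) * snd p j) * ?c ^ j"
  have "uniform_limit (hat_space r M) (\<lambda>n p. \<Sum>j<n. ?f j p) (\<lambda>p. suminf (\<lambda>j. ?f j p)) sequentially"
  proof (rule Weierstrass_m_test)
    show "summable (\<lambda>j. real ?R * ?c ^ j)"
      by (rule summable_expansion[of "\<lambda>_. real ?R" ?R]) simp
    fix j p assume p: "p \<in> hat_space r M"
    have "real (fst p j + (r + 1) * snd p j) \<le> real ?R" using hat_digit_le[OF p, of j] by linarith
    then show "norm (?f j p) \<le> real ?R * ?c ^ j"
      unfolding norm_mult by (intro mult_mono) (auto simp: norm_power)
  qed
  moreover have "continuous_on (hat_space r M) (\<lambda>p. \<Sum>j<n. ?f j p)" for n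
  proof (intro continuous_on_sum continuous_on_mult_right)
    fix j
    have real: "continuous_on UNIV (real :: nat \<Rightarrow> real)"
      by (simp add: continuous_on_open_vimage discrete_topology_class.open_discrete)
    have "continuous_on UNIV (\<lambda>p::symseq \<times> symseq. fst p j)"
      by (rule continuous_on_product_then_coordinatewise[OF continuous_on_fst[OF continuous_on_id]])
    moreover have "continuous_on UNIV (\<lambda>p::symseq \<times> symseq. snd p j)"
      by (rule continuous_on_product_then_coordinatewise[OF continuous_on_snd[OF continuous_on_id]])
    ultimately have "continuous_on UNIV (\<lambda>p::symseq \<times> symseq. real (fst p j) + (r + 1) * real (snd p j))"
      by (intro continuous_on_add continuous_on_mult_left continuous_on_compose2[OF real]) auto
    then have "continuous_on UNIV (\<lambda>p::symseq \<times> symseq. real (fst p j + (r + 1) * snd p j))"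
      by (simp only: of_nat_add of_nat_mult of_nat_1)
    then show "continuous_on (hat_space r M) (\<lambda>p. real (fst p j + (r + 1) * snd p j))"
      using continuous_on_subset by blast
  qed
  ultimately have "continuous_on (hat_space r M) (\<lambda>p. suminf (\<lambda>j. ?f j p))"
    by (intro uniform_limit_theorem[of _ _ sequentially]) auto
  then show ?thesis unfolding hat_code_def expansion_def by simp
qed

section \<open>Almost additive sequences and upper limits\<close>

text \<open>Comparing \<open>a (m * n)\<close> with \<open>m * a n\<close> and with \<open>n * a m\<close> shows that every \<open>(a n - K) / n\<close> lies below every
\<open>(a m + K) / m\<close>; any number in between works, for instance the infimum of the latter.\<close>

lemma almost_additive:
  fixes a :: "nat \<Rightarrow> real"
  assumes "\<And>m n. \<bar>a (m + n) - a m - a n\<bar> \<le> K"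
  obtains b where "\<And>n. \<bar>a n - real n * b\<bar> \<le> K"
proof -
  have mult: "\<bar>a (Suc m * n) - real (Suc m) * a n\<bar> \<le> m * K" for m n
  proof (induction m)
    case (Suc m)
    have "\<bar>a (n + Suc m * n) - a n - a (Suc m * n)\<bar> \<le> K" by (rule assms)
    with Suc show ?case by (simp add: algebra_simps)
  qed simp
  have le: "(a n - K) / n \<le> (a m + K) / m" if ge: "m \<ge> 1" "n \<ge> 1" for m n
  proof -
    obtain m' n' where mn: "m = Suc m'" "n = Suc n'"
      using ge by (cases m; cases n) auto
    have "K \<ge> 0" using assms[of 0 0] by linarith
    then have "\<bar>a (m * n) - m * a n\<bar> \<le> m * K" "\<bar>a (n * m) - n * a m\<bar> \<le> n * K"
      using mult[of m' n] mult[of n' m] unfolding mn by (simp_all add: algebra_simps)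
    then have "m * (a n - K) \<le> n * (a m + K)" by (simp add: algebra_simps)
    then show ?thesis using ge by (simp add: field_simps)
  qed
  define b where "b = (INF m\<in>{1..}. (a m + K) / m)"
  have "\<bar>a n - real n * b\<bar> \<le> K" for n
  proof (cases "n = 0")
    case True
    then show ?thesis using assms[of 0 0] by simp
  next
    case False
    then have "(a n - K) / n \<le> b"
      unfolding b_def by (intro cINF_greatest) (use le in auto)
    moreover have "b \<le> (a n + K) / n"
      unfolding b_def by (rule cINF_lower) (use False le[of _ 1] in \<open>auto intro!: bdd_belowI\<close>)
    ultimately show ?thesis using False by (simp add: field_simps abs_le_iff)
  qed
  then show thesis using that by blast
qed

definition upper_limit :: "(nat \<Rightarrow> real) \<Rightarrow> real" where
  "upper_limit s = Inf {c. \<forall>\<^sub>F n in sequentially. s n \<le> c}"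

lemma
  fixes s :: "nat \<Rightarrow> real"
  assumes s: "\<And>n. \<bar>s n\<bar> \<le> B" and "\<delta> > 0"
  shows eventually_less_upper_limit: "\<forall>\<^sub>F n in sequentially. s n < upper_limit s + \<delta>"
    and frequently_greater_upper_limit: "\<exists>\<^sub>F n in sequentially. upper_limit s - \<delta> < s n"
proof -
  let ?C = "{c. \<forall>\<^sub>F n in sequentially. s n \<le> c}"
  have "s n \<le> B" for n using s[of n] by linarith
  then have ne: "B \<in> ?C" by simp
  have "- B \<le> c" if c: "c \<in> ?C" for c
  proof -
    obtain n where "s n \<le> c" using c eventually_happens'[OF sequentially_bot] by blast
    then show ?thesis using s[of n] by linarith
  qed
  then have bdd: "bdd_below ?C" by (rule bdd_belowI)
  obtain c where "c \<in> ?C" "c < upper_limit s + \<delta>"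
    using cInf_lessD[of ?C "upper_limit s + \<delta>"] ne \<open>\<delta> > 0\<close> unfolding upper_limit_def by auto
  then show "\<forall>\<^sub>F n in sequentially. s n < upper_limit s + \<delta>"
    by (auto elim!: eventually_mono)
  have "upper_limit s - \<delta> \<notin> ?C"
    using cInf_lower[OF _ bdd, of "upper_limit s - \<delta>"] \<open>\<delta> > 0\<close> unfolding upper_limit_def by auto
  then show "\<exists>\<^sub>F n in sequentially. upper_limit s - \<delta> < s n"
    by (simp add: frequently_def not_less)
qed

section \<open>Walks under transitivity and their distortion\<close>

primrec endpoint :: "symseq list \<Rightarrow> symseq \<Rightarrow> symseq" where
  "endpoint [] x = x"
| "endpoint (y # ys) x = endpoint ys (tau (y, x))"

primrec steps :: "symseq list \<Rightarrow> symseq \<Rightarrow> (symseq \<times> symseq) list" where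
  "steps [] x = []"
| "steps (y # ys) x = (y, x) # steps ys (tau (y, x))"

lemma length_steps [simp]: "length (steps ys x) = length ys"
  by (induction ys arbitrary: x) auto

lemma steps_append: "steps (us @ vs) x = steps us x @ steps vs (endpoint us x)"
  by (induction us arbitrary: x) auto

lemma endpoint_append: "endpoint (us @ vs) x = endpoint vs (endpoint us x)"
  by (induction us arbitrary: x) auto

lemma steps_telescope:
  fixes g :: "symseq \<Rightarrow> real"
  shows "(\<Sum>p\<leftarrow>steps ys x. g (tau p) - g (snd p)) = g (endpoint ys x) - g x"
  by (induction ys arbitrary: x) auto

lemma steps_map_fst:
  assumes "p = [] \<or> snd (p ! 0) = x" "\<And>j. Suc j < length p \<Longrightarrow> snd (p ! Suc j) = tau (p ! j)"
  shows "steps (map fst p) x = p"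
  using assms
proof (induction p arbitrary: x)
  case (Cons q p)
  have q: "(fst q, x) = q" using Cons.prems(1) by auto
  have "p = [] \<or> snd (p ! 0) = tau q" using Cons.prems(2)[of 0] by (cases p) auto
  moreover have "snd (p ! Suc j) = tau (p ! j)" if "Suc j < length p" for j
    using Cons.prems(2)[of "Suc j"] that by simp
  ultimately have "steps (map fst p) (tau q) = p" by (rule Cons.IH)
  then show ?case using q by simp
qed simp

lemma steps_chain: "Suc j < length ys \<Longrightarrow> snd (steps ys x ! Suc j) = tau (steps ys x ! j)"
proof (induction ys arbitrary: x j)
  case (Cons y ys)
  then show ?case by (cases j; cases ys) auto
qed simp

lemma tau_last_step: "ys \<noteq> [] \<Longrightarrow> tau (steps ys x ! (length ys - 1)) = endpoint ys x"
proof (induction ys arbitrary: x)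
  case (Cons y ys)
  then show ?case by (cases ys) auto
qed simp

locale holder_subshift =
  fixes r :: nat and M :: "nat \<Rightarrow> nat \<Rightarrow> nat" and lam \<theta> :: real
    and A :: "symseq \<times> symseq \<Rightarrow> real"
  assumes nonempty: "shift_space r M \<noteq> {}"
    and lam: "0 < lam" "lam < 1"
    and transitive: "topologically_transitive (shift_topology r M lam) left_shift"
    and theta: "0 < \<theta>"
    and holder: "holder_on (hat_space r M) (hat_dist lam) \<theta> A"
begin

abbreviation "X \<equiv> shift_space r M"
abbreviation "H \<equiv> hat_space r M"
abbreviation "fibre \<equiv> dual_fibre r M"
abbreviation "d \<equiv> seq_dist lam"

definition walk :: "symseq list \<Rightarrow> symseq \<Rightarrow> bool" where
  "walk ys x \<longleftrightarrow> set (steps ys x) \<subseteq> H"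

definition gain :: "real \<Rightarrow> symseq list \<Rightarrow> symseq \<Rightarrow> real" where
  "gain b ys x = (\<Sum>p\<leftarrow>steps ys x. A p - b)"

lemma walk_Nil [simp]: "walk [] x"
  by (simp add: walk_def)

lemma walk_Cons [simp]: "walk (y # ys) x \<longleftrightarrow> (y, x) \<in> H \<and> walk ys (tau (y, x))"
  by (simp add: walk_def)

lemma walk_append: "walk (us @ vs) x \<longleftrightarrow> walk us x \<and> walk vs (endpoint us x)"
  by (simp add: walk_def steps_append)

lemma gain_Nil [simp]: "gain b [] x = 0"
  by (simp add: gain_def)

lemma gain_Cons [simp]: "gain b (y # ys) x = A (y, x) - b + gain b ys (tau (y, x))"
  by (simp add: gain_def)

lemma gain_append: "gain b (us @ vs) x = gain b us x + gain b vs (endpoint us x)"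
  by (simp add: gain_def steps_append)

lemma fibre_iff: "x \<in> X \<Longrightarrow> y \<in> fibre x \<longleftrightarrow> (y, x) \<in> H"
  by (auto simp: dual_fibre_def hat_space_def)

lemma tau_0 [simp]: "tau (y, x) 0 = y 0"
  by (simp add: tau_def)

lemma tau_mem: "(y, x) \<in> H \<Longrightarrow> tau (y, x) \<in> X"
  unfolding hat_space_def dual_space_def shift_space_def tau_def
  by (auto split: nat.split)

lemma hat_mem_X: "(y, x) \<in> H \<Longrightarrow> x \<in> X"
  by (auto simp: hat_space_def)

lemma endpoint_mem: "x \<in> X \<Longrightarrow> walk ys x \<Longrightarrow> endpoint ys x \<in> X"
  by (induction ys arbitrary: x) (auto simp: tau_mem)

lemma hat_mem_cong: "(y, x) \<in> H \<Longrightarrow> z \<in> X \<Longrightarrow> x 0 = z 0 \<Longrightarrow> (y, z) \<in> H"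
  by (auto simp: hat_space_def)

lemma walk_cong: "walk ys x \<Longrightarrow> z \<in> X \<Longrightarrow> x 0 = z 0 \<Longrightarrow> walk ys z"
proof (induction ys arbitrary: x z)
  case (Cons y ys)
  then have "(y, z) \<in> H" using hat_mem_cong by auto
  then show ?case using Cons.IH[of "tau (y, x)" "tau (y, z)"] Cons.prems tau_mem by simp
qed simp

lemma d_tau: "d (tau (y, x)) (tau (y, z)) = lam * d x z"
  unfolding tau_def by (simp add: seq_dist_case_nat[OF lam])

lemma d_endpoint: "d (endpoint ys x) (endpoint ys z) = lam ^ length ys * d x z"
  by (induction ys arbitrary: x z) (auto simp: d_tau)

lemma d_nonneg [simp]: "0 \<le> d x z" by (rule seq_dist_nonneg[OF lam(1)])
lemma d_le_1: "d x z \<le> 1" by (rule seq_dist_le_1[OF lam])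
lemma d_less_1_iff: "d x z < 1 \<longleftrightarrow> x 0 = z 0" by (rule seq_dist_less_1_iff[OF lam])
lemma d_self [simp]: "d x x = 0" by (simp add: seq_dist_def)

lemma lam_powr: "lam powr \<theta> < 1"
  using powr_less_mono2[OF theta _ lam(2)] lam(1) by simp

text \<open>The two copies of the path approach each other geometrically, so the differences of \<open>A\<close> form a geometric
series with ratio \<open>lam powr \<theta>\<close>. The constant \<open>b\<close> cancels in the difference.\<close>

lemma distortion_exists:
  "\<exists>D\<ge>0. \<forall>b ys x z. walk ys x \<longrightarrow> x \<in> X \<longrightarrow> z \<in> X \<longrightarrow> x 0 = z 0 \<longrightarrow>
    \<bar>gain b ys x - gain b ys z\<bar> \<le> D * d x z powr \<theta>"
proof -
  obtain C0 where C0: "\<And>p q. p \<in> H \<Longrightarrow> q \<in> H \<Longrightarrow> \<bar>A p - A q\<bar> \<le> C0 * hat_dist lam p q powr \<theta>"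
    using holder unfolding holder_on_def by blast
  define C where "C = max C0 0"
  have C: "\<bar>A (y, x) - A (y, z)\<bar> \<le> C * d x z powr \<theta>" if "(y, x) \<in> H" "(y, z) \<in> H" for y x z
  proof -
    have "hat_dist lam (y, x) (y, z) = d x z" by (simp add: hat_dist_def)
    then have "\<bar>A (y, x) - A (y, z)\<bar> \<le> C0 * d x z powr \<theta>" using C0[OF that] by simp
    also have "\<dots> \<le> C * d x z powr \<theta>" unfolding C_def by (intro mult_right_mono) auto
    finally show ?thesis .
  qed
  define D where "D = C / (1 - lam powr \<theta>)"
  have D: "D \<ge> 0" "C + D * lam powr \<theta> = D"
    using lam_powr by (simp_all add: D_def C_def field_simps)
  have "\<bar>gain b ys x - gain b ys z\<bar> \<le> D * d x z powr \<theta>"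
    if "walk ys x" "x \<in> X" "z \<in> X" "x 0 = z 0" for b ys x z
    using that
  proof (induction ys arbitrary: x z)
    case Nil
    then show ?case using D(1) by simp
  next
    case (Cons y ys)
    then have H: "(y, x) \<in> H" "(y, z) \<in> H" using hat_mem_cong by auto
    have "\<bar>gain b ys (tau (y, x)) - gain b ys (tau (y, z))\<bar> \<le> D * d (tau (y, x)) (tau (y, z)) powr \<theta>"
      using Cons.prems H by (intro Cons.IH) (auto simp: tau_mem)
    also have "\<dots> = (D * lam powr \<theta>) * d x z powr \<theta>"
      unfolding d_tau using lam by (simp add: powr_mult)
    finally have "\<bar>gain b (y # ys) x - gain b (y # ys) z\<bar> \<le> (C + D * lam powr \<theta>) * d x z powr \<theta>"
      using C[OF H] by (simp add: algebra_simps)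
    then show ?case unfolding D(2) .
  qed
  with D(1) show ?thesis by blast
qed

definition distortion :: real where
  "distortion = (SOME D. D \<ge> 0 \<and> (\<forall>b ys x z. walk ys x \<longrightarrow> x \<in> X \<longrightarrow> z \<in> X \<longrightarrow> x 0 = z 0 \<longrightarrow>
    \<bar>gain b ys x - gain b ys z\<bar> \<le> D * d x z powr \<theta>))"

lemma
  shows distortion_nonneg: "distortion \<ge> 0"
    and gain_distortion: "\<lbrakk>walk ys x; x \<in> X; z \<in> X; x 0 = z 0\<rbrakk> \<Longrightarrow>
      \<bar>gain b ys x - gain b ys z\<bar> \<le> distortion * d x z powr \<theta>"
  using someI_ex[OF distortion_exists[unfolded Bex_def]] unfolding distortion_def by blast+

lemma continuous_on_A: "continuous_on H A"
proof (rule holder_continuous_on[OF _ _ lam theta _ holder])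
  show "hat_dist lam p q \<le> lam ^ n \<longleftrightarrow> q \<in> cyl n (fst p) \<times> cyl n (snd p)" for p n q
    by (rule hat_dist_le_power_iff[OF lam])
  show "0 \<le> hat_dist lam p q" for p q
    by (simp add: hat_dist_def le_max_iff_disj)
qed (auto intro!: open_Times open_cyl simp: mem_Times_iff)

lemma bounded_on_H:
  fixes g :: "symseq \<times> symseq \<Rightarrow> real"
  assumes "continuous_on H g"
  obtains B where "B \<ge> 0" "\<And>p. p \<in> H \<Longrightarrow> \<bar>g p\<bar> \<le> B"
  using compact_imp_bounded[OF compact_continuous_image[OF assms compact_hat_space]]
  unfolding bounded_pos by (auto intro: less_imp_le)

lemma shift_iterate: "(left_shift ^^ k) x = (\<lambda>j. x (k + j))"
  by (induction k arbitrary: x) (auto simp: left_shift_def funpow_swap1)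

lemma shift_iterate_mem: "x \<in> X \<Longrightarrow> (\<lambda>j. x (k + j)) \<in> X"
  by (auto simp: shift_space_def)

text \<open>Transitivity, applied to the cylinders of length one around the two points.\<close>

lemma transitive_symbols:
  assumes "x \<in> X" "z \<in> X"
  obtains w k where "k \<ge> 1" "w \<in> X" "w 0 = x 0" "w k = z 0"
proof -
  have "openin (shift_topology r M lam) (X \<inter> cyl 1 v)" for v
    unfolding shift_topology_eq[OF lam] using open_cyl[of 1 v] by (auto simp: openin_open)
  moreover have "X \<inter> cyl 1 v \<noteq> {}" if "v \<in> X" for v using that by auto
  ultimately obtain k where k: "k \<ge> 1" "(left_shift ^^ k) ` (X \<inter> cyl 1 x) \<inter> (X \<inter> cyl 1 z) \<noteq> {}"
    using transitive assms unfolding topologically_transitive_def by meson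
  then obtain w where "w \<in> X" "w \<in> cyl 1 x" "(left_shift ^^ k) w \<in> cyl 1 z" by blast
  then show thesis using that[of k w] k(1) by (auto simp: cyl_def shift_iterate)
qed

text \<open>By transitivity the first symbol of every point has a predecessor that occurs in the space. Iterating the
choice of a predecessor builds a left-infinite sequence.\<close>

lemma fibre_nonempty:
  assumes "x \<in> X"
  obtains y where "(y, x) \<in> H"
proof -
  have pre: "\<exists>w\<in>X. M (w 0) (z 0) = 1" if z: "z \<in> X" for z
  proof -
    obtain w k where wk: "k \<ge> 1" "w \<in> X" "w k = z 0"
      using transitive_symbols[OF z z] by metis
    then obtain l where "k = Suc l" by (metis One_nat_def Suc_le_D)
    moreover have "M (w l) (w (Suc l)) = 1" using wk(2) by (simp add: shift_space_def)
    ultimately show ?thesis using wk(3) shift_iterate_mem[OF wk(2), of l]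
      by (intro bexI[of _ "\<lambda>j. w (l + j)"]) auto
  qed
  then obtain p where p: "\<And>z. z \<in> X \<Longrightarrow> p z \<in> X \<and> M (p z 0) (z 0) = 1" by metis
  define y where "y n = (p ^^ Suc n) x 0" for n
  have mem: "(p ^^ n) x \<in> X" for n by (induction n) (use assms p in auto)
  then have "y n \<in> {1..r}" for n
    unfolding y_def using mem[of "Suc n"] by (auto simp: shift_space_def)
  moreover have "M (y (Suc n)) (y n) = 1" for n
    unfolding y_def using p[OF mem[of "Suc n"]] by simp
  moreover have "M (y 0) (x 0) = 1" unfolding y_def using p[OF assms] by simp
  ultimately have "(y, x) \<in> H" using assms by (auto simp: hat_space_def dual_space_def)
  then show thesis by (rule that)
qed

lemma dual_starting_with:
  assumes "v \<in> X"
  obtains y where "y \<in> dual_space r M" "y 0 = v 0"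
proof -
  obtain y where "(y, v) \<in> H" using fibre_nonempty[OF assms] .
  then have "case_nat (v 0) y \<in> dual_space r M"
    using assms by (auto simp: hat_space_def dual_space_def shift_space_def split: nat.split)
  then show thesis using that[of "case_nat (v 0) y"] by simp
qed

lemma walk_along:
  assumes "w \<in> X" "z \<in> X" "w k = z 0"
  shows "\<exists>ys. walk ys z \<and> endpoint ys z 0 = w 0"
  using assms(2,3)
proof (induction k arbitrary: z)
  case 0
  then show ?case by (intro exI[of _ "[]"]) simp
next
  case (Suc k)
  obtain y where y: "y \<in> dual_space r M" "y 0 = w k"
    using dual_starting_with[OF shift_iterate_mem[OF assms(1), of k]] by auto
  have "M (w k) (w (Suc k)) = 1" using assms(1) by (simp add: shift_space_def)
  then have H: "(y, z) \<in> H" using y Suc.prems by (simp add: hat_space_def)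
  then obtain ys where "walk ys (tau (y, z))" "endpoint ys (tau (y, z)) 0 = w 0"
    using Suc.IH[of "tau (y, z)"] tau_mem y(2) by auto
  then show ?case using H by (intro exI[of _ "y # ys"]) simp
qed

lemma connecting_walk:
  assumes "x \<in> X" "z \<in> X"
  shows "\<exists>ys. walk ys z \<and> endpoint ys z 0 = x 0"
proof -
  obtain w k where "w \<in> X" "w 0 = x 0" "w k = z 0" using transitive_symbols[OF assms] by metis
  then show ?thesis using walk_along[of w z k] assms by simp
qed

lemma endpoint_0_cong: "x 0 = z 0 \<Longrightarrow> endpoint ys x 0 = endpoint ys z 0"
proof (induction ys arbitrary: x z)
  case (Cons y ys)
  show ?case using Cons.IH[of "tau (y, x)" "tau (y, z)"] by simp
qed simp

text \<open>Whether a list of dual points is a connecting walk depends only on the two first symbols, so finitely many walks suffice.\<close>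

lemma connecting_walk_bounded:
  obtains N where "\<And>x z. x \<in> X \<Longrightarrow> z \<in> X \<Longrightarrow>
    \<exists>ys. length ys \<le> N \<and> walk ys z \<and> endpoint ys z 0 = x 0"
proof -
  let ?P = "\<lambda>N (a, c). \<forall>x z. x \<in> X \<longrightarrow> z \<in> X \<longrightarrow> x 0 = a \<longrightarrow> z 0 = c \<longrightarrow>
    (\<exists>ys. length ys \<le> N \<and> walk ys z \<and> endpoint ys z 0 = x 0)"
  have "\<forall>\<^sub>F N in sequentially. ?P N q" for q
  proof (cases "\<exists>x z. x \<in> X \<and> z \<in> X \<and> x 0 = fst q \<and> z 0 = snd q")
    case True
    then obtain x0 z0 where xz: "x0 \<in> X" "z0 \<in> X" "x0 0 = fst q" "z0 0 = snd q" by blast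
    then obtain ys where ys: "walk ys z0" "endpoint ys z0 0 = x0 0" using connecting_walk by blast
    have "?P N q" if "N \<ge> length ys" for N
      using walk_cong[OF ys(1)] endpoint_0_cong[of z0 _ ys] ys(2) xz that
      by (auto split: prod.split intro!: exI[of _ ys])
    then show ?thesis by (auto simp: eventually_sequentially)
  next
    case False
    then have "?P N q" for N unfolding case_prod_unfold by blast
    then show ?thesis by simp
  qed
  then have "\<forall>\<^sub>F N in sequentially. \<forall>q\<in>{1..r} \<times> {1..r}. ?P N q"
    by (intro eventually_ball_finite) auto
  then obtain N where N: "\<forall>q\<in>{1..r} \<times> {1..r}. ?P N q"
    using eventually_happens'[OF sequentially_bot] by blast
  show thesis
  proof (rule that)
    fix x z assume "x \<in> X" "z \<in> X"
    moreover from this have "(x 0, z 0) \<in> {1..r} \<times> {1..r}" by (auto simp: shift_space_def)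
    ultimately show "\<exists>ys. length ys \<le> N \<and> walk ys z \<and> endpoint ys z 0 = x 0"
      using N by blast
  qed
qed

lemma walk_exists: "x \<in> X \<Longrightarrow> \<exists>ys. length ys = n \<and> walk ys x"
proof (induction n arbitrary: x)
  case (Suc n)
  obtain y where y: "(y, x) \<in> H" using fibre_nonempty[OF Suc.prems] .
  then obtain ys where "length ys = n" "walk ys (tau (y, x))" using Suc.IH tau_mem by blast
  with y show ?case by (intro exI[of _ "y # ys"]) simp
qed simp

lemma finite_successors: "finite {tau (y, x) |y. (y, x) \<in> H}"
proof (rule finite_subset)
  show "{tau (y, x) |y. (y, x) \<in> H} \<subseteq> (\<lambda>i. case_nat i x) ` {1..r}"
    by (auto simp: tau_def hat_space_def dual_space_def)
qed simp

text \<open>The value of \<open>u\<close> depends on \<open>y\<close> only through its first symbol, so it is a locally constant function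
of \<open>y\<close>, and the function to be minimised is continuous on the compact fibre.\<close>

lemma minimum_over_fibre_attained:
  assumes x: "x \<in> X"
    and approx: "\<And>\<delta>. \<delta> > 0 \<Longrightarrow> \<exists>y. (y, x) \<in> H \<and> u (tau (y, x)) - (A (y, x) - b) \<le> c + \<delta>"
  shows "\<exists>y. (y, x) \<in> H \<and> u (tau (y, x)) - (A (y, x) - b) \<le> c"
proof -
  let ?g = "\<lambda>y. u (tau (y, x)) - (A (y, x) - b)"
  have "continuous_on UNIV (\<lambda>i. u (case_nat i x))"
    by (simp add: continuous_on_open_vimage discrete_topology_class.open_discrete)
  then have "continuous_on (fibre x) (\<lambda>y. u (case_nat (y 0) x))"
    by (rule continuous_on_compose2) (auto intro: continuous_on_subset[OF continuous_on_coordinate])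
  then have "continuous_on (fibre x) (\<lambda>y. u (tau (y, x)))"
    by (simp add: tau_def)
  moreover have "continuous_on (fibre x) (\<lambda>y. A (y, x))"
    by (rule continuous_on_compose2[OF continuous_on_A])
      (auto intro!: continuous_intros simp: fibre_iff[OF x])
  ultimately have "continuous_on (fibre x) ?g" by (intro continuous_intros)
  moreover have "fibre x \<noteq> {}" using fibre_nonempty[OF x] fibre_iff[OF x] by blast
  ultimately obtain y where y: "y \<in> fibre x" "\<And>z. z \<in> fibre x \<Longrightarrow> ?g y \<le> ?g z"
    using continuous_attains_inf[OF compact_dual_fibre[OF x]] by blast
  have "?g y \<le> c"
  proof (rule field_le_epsilon)
    fix \<delta> :: real assume "\<delta> > 0"
    from approx[OF this] obtain z where "(z, x) \<in> H" "?g z \<le> c + \<delta>" by blast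
    then show "?g y \<le> c + \<delta>" using y(2)[of z] fibre_iff[OF x] by auto
  qed
  then show ?thesis using y(1) fibre_iff[OF x] by blast
qed

text \<open>Within one of the finitely many cylinders of length one the function oscillates by at most \<open>D\<close>.\<close>

lemma bounded_of_locally_holder:
  assumes D: "D \<ge> 0" "\<And>x z. x \<in> X \<Longrightarrow> z \<in> X \<Longrightarrow> x 0 = z 0 \<Longrightarrow> u x - u z \<le> D * d x z powr \<theta>"
  obtains B where "\<And>x. x \<in> X \<Longrightarrow> \<bar>u x\<bar> \<le> B"
proof -
  have "\<forall>\<^sub>F B in at_top. \<forall>x\<in>X. x 0 = a \<longrightarrow> \<bar>u x\<bar> \<le> B" for a
  proof (cases "\<exists>x\<in>X. x 0 = a")
    case True
    then obtain z where z: "z \<in> X" "z 0 = a" by blast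
    have "\<bar>u x\<bar> \<le> \<bar>u z\<bar> + D" if "x \<in> X" "x 0 = a" for x
    proof -
      have "D * d p q powr \<theta> \<le> D" for p q
        using D(1) d_le_1[of p q] theta by (intro mult_left_le powr_le1) auto
      then show ?thesis using D(2)[of x z] D(2)[of z x] that z by (smt (verit))
    qed
    note bound = this
    show ?thesis
    proof (rule eventually_mono[OF eventually_ge_at_top[of "\<bar>u z\<bar> + D"]], intro ballI impI)
      fix B x assume "\<bar>u z\<bar> + D \<le> B" "x \<in> X" "x 0 = a"
      then show "\<bar>u x\<bar> \<le> B" using bound[of x] by linarith
    qed
  next
    case False
    then show ?thesis by (intro always_eventually) blast
  qed
  then have "\<forall>\<^sub>F B in at_top. \<forall>a\<in>{1..r}. \<forall>x\<in>X. x 0 = a \<longrightarrow> \<bar>u x\<bar> \<le> B"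
    by (intro eventually_ball_finite) auto
  then obtain B where "\<forall>a\<in>{1..r}. \<forall>x\<in>X. x 0 = a \<longrightarrow> \<bar>u x\<bar> \<le> B"
    using eventually_happens'[OF trivial_limit_at_top_linorder] by blast
  moreover have "x 0 \<in> {1..r}" if "x \<in> X" for x
    using that by (auto simp: shift_space_def)
  ultimately show thesis using that by blast
qed

text \<open>Points with different first symbols have distance one, and there boundedness is enough.\<close>

lemma holder_of_locally_holder:
  assumes D: "D \<ge> 0" "\<And>x z. x \<in> X \<Longrightarrow> z \<in> X \<Longrightarrow> x 0 = z 0 \<Longrightarrow> u x - u z \<le> D * d x z powr \<theta>"
  shows "holder_on X d \<theta> u"
proof -
  obtain B where B: "\<And>x. x \<in> X \<Longrightarrow> \<bar>u x\<bar> \<le> B" using bounded_of_locally_holder[OF D] by blast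
  have "\<bar>u x - u z\<bar> \<le> max D (2 * B) * d x z powr \<theta>" if xz: "x \<in> X" "z \<in> X" for x z
  proof (cases "x 0 = z 0")
    case True
    have "u x - u z \<le> D * d x z powr \<theta>" "u z - u x \<le> D * d x z powr \<theta>"
      using D(2)[OF xz True] D(2)[OF xz(2,1)] True seq_dist_commute[of lam x z] by auto
    moreover have "D * d x z powr \<theta> \<le> max D (2 * B) * d x z powr \<theta>"
      by (intro mult_right_mono) auto
    ultimately show ?thesis by linarith
  next
    case False
    then have "d x z = 1" using d_less_1_iff[of x z] d_le_1[of x z] by linarith
    then show ?thesis using B[OF xz(1)] B[OF xz(2)] by simp
  qed
  then show ?thesis unfolding holder_on_def by blast
qed

lemma continuous_on_of_holder: "holder_on X d \<theta> u \<Longrightarrow> continuous_on X u"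
  by (rule holder_continuous_on[OF seq_dist_le_power_iff[OF lam] open_cyl lam theta d_nonneg])
    (auto)

section \<open>The growth rate of optimal walks\<close>

definition best :: "nat \<Rightarrow> symseq \<Rightarrow> real" where
  "best n x = (SUP ys\<in>{ys. length ys = n \<and> walk ys x}. gain 0 ys x)"

lemma gain_bounded:
  obtains K where "K \<ge> 0"
    "\<And>ys x. walk ys x \<Longrightarrow> \<bar>gain 0 ys x\<bar> \<le> real (length ys) * K"
proof -
  obtain B where B: "B \<ge> 0" "\<And>p. p \<in> H \<Longrightarrow> \<bar>A p\<bar> \<le> B" using bounded_on_H[OF continuous_on_A] by blast
  have "\<bar>gain 0 ys x\<bar> \<le> real (length ys) * B" if "walk ys x" for ys x
    using that
  proof (induction ys arbitrary: x)
    case (Cons y ys)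
    have "\<bar>gain 0 ys (tau (y, x))\<bar> \<le> real (length ys) * B" "\<bar>A (y, x)\<bar> \<le> B"
      using B(2)[of "(y, x)"] Cons.IH[of "tau (y, x)"] Cons.prems by auto
    then show ?case by (simp add: distrib_right)
  qed simp
  with B(1) show thesis by (rule that)
qed

lemma gain_le_best:
  assumes "walk ys x" "length ys = n"
  shows "gain 0 ys x \<le> best n x"
proof -
  obtain K where "\<And>ys x. walk ys x \<Longrightarrow> \<bar>gain 0 ys x\<bar> \<le> real (length ys) * K" using gain_bounded by metis
  then have "bdd_above ((\<lambda>ys. gain 0 ys x) ` {ys. length ys = n \<and> walk ys x})"
    by (intro bdd_aboveI[of _ "n * K"]) (fastforce simp: abs_le_iff)
  then show ?thesis unfolding best_def using assms by (intro cSUP_upper) auto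
qed

lemma best_less:
  assumes "x \<in> X" "\<delta> > 0"
  obtains ys where "walk ys x" "length ys = n" "best n x < gain 0 ys x + \<delta>"
proof -
  obtain K where "\<And>ys x. walk ys x \<Longrightarrow> \<bar>gain 0 ys x\<bar> \<le> real (length ys) * K" using gain_bounded by metis
  then have "bdd_above ((\<lambda>ys. gain 0 ys x) ` {ys. length ys = n \<and> walk ys x})"
    by (intro bdd_aboveI[of _ "n * K"]) (fastforce simp: abs_le_iff)
  moreover have "{ys. length ys = n \<and> walk ys x} \<noteq> {}" using walk_exists[OF assms(1)] by blast
  moreover have "best n x - \<delta> < best n x" using assms by simp
  ultimately obtain ys where "ys \<in> {ys. length ys = n \<and> walk ys x}" "best n x - \<delta> < gain 0 ys x"
    using less_cSUP_iff[of "{ys. length ys = n \<and> walk ys x}" "\<lambda>ys. gain 0 ys x" "best n x - \<delta>"]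
    unfolding best_def by blast
  then show thesis using that[of ys] by auto
qed

lemma best_leI:
  assumes "x \<in> X" "\<And>ys. walk ys x \<Longrightarrow> length ys = n \<Longrightarrow> gain 0 ys x \<le> c"
  shows "best n x \<le> c"
  unfolding best_def using walk_exists[OF assms(1)] assms(2) by (intro cSUP_least) auto

lemma best_distortion:
  assumes "x \<in> X" "z \<in> X" "x 0 = z 0"
  shows "best n x \<le> best n z + distortion * d x z powr \<theta>"
proof (rule best_leI[OF assms(1)])
  fix ys assume ys: "walk ys x" "length ys = n"
  then have "gain 0 ys z \<le> best n z" using walk_cong assms by (intro gain_le_best) auto
  then show "gain 0 ys x \<le> best n z + distortion * d x z powr \<theta>"
    using gain_distortion[OF ys(1) assms, of 0] by linarith
qed

text \<open>From \<open>z\<close>, walk to a point with the first symbol of \<open>x\<close> in boundedly many steps, then imitate the walk from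
\<open>x\<close>, and cut off the surplus steps at the end. Each of the three operations costs a bounded amount.\<close>

lemma best_oscillation:
  obtains K where "\<And>n x z. x \<in> X \<Longrightarrow> z \<in> X \<Longrightarrow> best n x \<le> best n z + K"
proof -
  obtain B where B: "B \<ge> 0" "\<And>ys x. walk ys x \<Longrightarrow> \<bar>gain 0 ys x\<bar> \<le> real (length ys) * B"
    using gain_bounded by metis
  obtain N where N: "\<And>x z. x \<in> X \<Longrightarrow> z \<in> X \<Longrightarrow>
      \<exists>ys. length ys \<le> N \<and> walk ys z \<and> endpoint ys z 0 = x 0"
    using connecting_walk_bounded by blast
  have "best n x \<le> best n z + (distortion + 2 * (real N * B))" if xz: "x \<in> X" "z \<in> X" for n x z
  proof (rule best_leI[OF xz(1)])
    fix ys assume ys: "walk ys x" "length ys = n"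
    obtain us where us: "length us \<le> N" "walk us z" "endpoint us z 0 = x 0" using N[OF xz] by blast
    define z' where "z' = endpoint us z"
    have z': "z' \<in> X" "x 0 = z' 0" unfolding z'_def using endpoint_mem xz us by auto
    have "walk ys z'" using walk_cong ys z' by blast
    then have w: "walk (us @ ys) z" using us unfolding z'_def by (simp add: walk_append)
    have le: "real (length us) * B \<le> real N * B" using us B(1) by (intro mult_right_mono) auto
    define ps qs where "ps = take n (us @ ys)" and "qs = drop n (us @ ys)"
    have pq: "us @ ys = ps @ qs" "length ps = n" "length qs = length us"
      unfolding ps_def qs_def by (simp_all only: append_take_drop_id) (use ys in simp_all)
    have wp: "walk ps z" "walk qs (endpoint ps z)" using w unfolding pq walk_append by auto
    have "gain 0 ys x \<le> gain 0 ys z' + distortion * d x z' powr \<theta>"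
      using gain_distortion[OF ys(1) xz(1) z', of 0] by linarith
    also have "d x z' powr \<theta> \<le> 1" using d_le_1 theta by (intro powr_le1) auto
    then have "distortion * d x z' powr \<theta> \<le> distortion"
      using distortion_nonneg by (simp add: mult_left_le)
    also have "gain 0 ys z' = gain 0 (us @ ys) z - gain 0 us z" unfolding z'_def gain_append by simp
    also have "gain 0 (us @ ys) z = gain 0 ps z + gain 0 qs (endpoint ps z)" unfolding pq gain_append ..
    finally show "gain 0 ys x \<le> best n z + (distortion + 2 * (real N * B))"
      using B(2)[OF us(2)] B(2)[OF wp(2)] le pq(3) gain_le_best[OF wp(1) pq(2)]
      by (simp add: abs_le_iff)
  qed
  then show thesis by (rule that)
qed

text \<open>A walk of length \<open>m + n\<close> splits into two walks, and the starting point of the second one does not matter up to \<open>K\<close>.\<close>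

lemma best_add:
  assumes K: "\<And>n x z. x \<in> X \<Longrightarrow> z \<in> X \<Longrightarrow> best n x \<le> best n z + K" and x: "x \<in> X"
  shows "\<bar>best (m + n) x - best m x - best n x\<bar> \<le> K"
proof -
  have "best (m + n) x \<le> best m x + best n x + K"
  proof (rule best_leI[OF x])
    fix ys assume ys: "walk ys x" "length ys = m + n"
    define ps qs where "ps = take m ys" and "qs = drop m ys"
    have pq: "ys = ps @ qs" "length ps = m" "length qs = n"
      using ys unfolding ps_def qs_def by auto
    have wp: "walk ps x" "walk qs (endpoint ps x)" using ys(1) unfolding pq walk_append by auto
    have "best n (endpoint ps x) \<le> best n x + K" using K endpoint_mem[OF x wp(1)] x by blast
    then show "gain 0 ys x \<le> best m x + best n x + K"
      unfolding pq(1) gain_append using gain_le_best[OF wp(1) pq(2)] gain_le_best[OF wp(2) pq(3)] by linarith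
  qed
  moreover have "best m x + best n x - K \<le> best (m + n) x"
  proof (rule field_le_epsilon)
    fix e :: real assume "e > 0"
    then have e: "e / 2 > 0" by simp
    obtain ps where ps: "walk ps x" "length ps = m" "best m x < gain 0 ps x + e / 2"
      using best_less[OF x e] .
    have z: "endpoint ps x \<in> X" using endpoint_mem[OF x ps(1)] .
    obtain qs where qs: "walk qs (endpoint ps x)" "length qs = n"
        "best n (endpoint ps x) < gain 0 qs (endpoint ps x) + e / 2"
      using best_less[OF z e] .
    have "gain 0 (ps @ qs) x \<le> best (m + n) x"
      using ps qs by (intro gain_le_best) (auto simp: walk_append)
    moreover have "best n x \<le> best n (endpoint ps x) + K" using K x z by blast
    ultimately show "best m x + best n x - K \<le> best (m + n) x + e"
      using ps(3) qs(3) unfolding gain_append by argo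
  qed
  ultimately show ?thesis by linarith
qed

lemma growth_rate_exists: "\<exists>b K. \<forall>n. \<forall>x\<in>X. \<bar>best n x - real n * b\<bar> \<le> K"
proof -
  obtain K where K: "\<And>n x z. x \<in> X \<Longrightarrow> z \<in> X \<Longrightarrow> best n x \<le> best n z + K"
    using best_oscillation by blast
  obtain x where x: "x \<in> X" using nonempty by blast
  obtain b where b: "\<And>n. \<bar>best n x - real n * b\<bar> \<le> K"
    using almost_additive[OF best_add[OF K x]] by blast
  have "\<bar>best n z - real n * b\<bar> \<le> 2 * K" if "z \<in> X" for n z
    using b[of n] K[OF x that, of n] K[OF that x, of n] by linarith
  then show ?thesis by blast
qed

text \<open>The linear growth rate of the best gain; it turns out to be the maximal holonomic integral.\<close>

definition rate :: real where
  "rate = (SOME b. \<exists>K. \<forall>n. \<forall>x\<in>X. \<bar>best n x - real n * b\<bar> \<le> K)"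

lemma best_rate: obtains K where "\<And>n x. x \<in> X \<Longrightarrow> \<bar>best n x - real n * rate\<bar> \<le> K"
  using someI_ex[OF growth_rate_exists] unfolding rate_def by blast

section \<open>A reference calibrated sub-action\<close>

text \<open>The sign turns the value function of a maximisation problem into a sub-action.\<close>

definition base :: "symseq \<Rightarrow> real" where
  "base x = - upper_limit (\<lambda>n. best n x - real n * rate)"

lemma
  assumes "x \<in> X" "\<delta> > 0"
  shows eventually_best_less: "\<forall>\<^sub>F n in sequentially. best n x - real n * rate < - base x + \<delta>"
    and frequently_best_greater: "\<exists>\<^sub>F n in sequentially. - base x - \<delta> < best n x - real n * rate"
proof -
  obtain K where K: "\<And>n x. x \<in> X \<Longrightarrow> \<bar>best n x - real n * rate\<bar> \<le> K" using best_rate by blast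
  show "\<forall>\<^sub>F n in sequentially. best n x - real n * rate < - base x + \<delta>"
    using eventually_less_upper_limit[OF K[OF assms(1)] assms(2)] by (simp add: base_def)
  show "\<exists>\<^sub>F n in sequentially. - base x - \<delta> < best n x - real n * rate"
    using frequently_greater_upper_limit[OF K[OF assms(1)] assms(2)] by (simp add: base_def)
qed

text \<open>The first step of a walk of length \<open>n + 1\<close> may be any admissible one; pass to the upper limit.\<close>

lemma base_subaction:
  assumes H: "(y, x) \<in> H"
  shows "base x \<le> base (tau (y, x)) - (A (y, x) - rate)"
proof (rule field_le_epsilon)
  fix e :: real assume "e > 0"
  then have e: "e / 2 > 0" by simp
  have x: "x \<in> X" "tau (y, x) \<in> X" using H hat_mem_X tau_mem by auto
  have step: "best n (tau (y, x)) \<le> best (Suc n) x - A (y, x)" for n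
  proof (rule best_leI[OF x(2)])
    fix ys assume "walk ys (tau (y, x))" "length ys = n"
    then show "gain 0 ys (tau (y, x)) \<le> best (Suc n) x - A (y, x)"
      using gain_le_best[of "y # ys" x "Suc n"] H by simp
  qed
  have "\<forall>\<^sub>F n in sequentially. best (Suc n) x - real (Suc n) * rate < - base x + e / 2"
    using eventually_best_less[OF x(1) e] by (subst eventually_sequentially_Suc)
  from frequently_eventually_frequently[OF frequently_best_greater[OF x(2) e] this]
  obtain n where "- base (tau (y, x)) - e / 2 < best n (tau (y, x)) - real n * rate"
    "best (Suc n) x - real (Suc n) * rate < - base x + e / 2"
    using frequently_ex by blast
  then show "base x \<le> base (tau (y, x)) - (A (y, x) - rate) + e"
    using step[of n] by (simp add: algebra_simps)
qed

text \<open>An almost optimal walk of length \<open>n + 1\<close> has a first step whose successor is one of finitely many points. The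
upper bounds for the remaining gain hold at all of these points simultaneously from some \<open>n\<close> on, and frequently
the best gain from \<open>x\<close> is close to its upper limit.\<close>

lemma base_calibrated:
  assumes x: "x \<in> X"
  shows "\<exists>y. (y, x) \<in> H \<and> base (tau (y, x)) - (A (y, x) - rate) \<le> base x"
proof (rule minimum_over_fibre_attained[OF x])
  fix \<delta> :: real assume "\<delta> > 0"
  then have e: "\<delta> / 3 > 0" by simp
  let ?Z = "{tau (y, x) |y. (y, x) \<in> H}"
  have freq: "\<exists>\<^sub>F n in sequentially. - base x - \<delta> / 3 < best (Suc n) x - real (Suc n) * rate"
    using frequently_best_greater[OF x e]
      eventually_sequentially_Suc[of "\<lambda>n. \<not> - base x - \<delta> / 3 < best n x - real n * rate"]
    unfolding frequently_def by blast
  have ev: "\<forall>\<^sub>F n in sequentially. \<forall>z\<in>?Z. best n z - real n * rate < - base z + \<delta> / 3"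
  proof (intro eventually_ball_finite finite_successors ballI)
    fix z assume "z \<in> ?Z"
    then have "z \<in> X" by (auto intro: tau_mem)
    then show "\<forall>\<^sub>F n in sequentially. best n z - real n * rate < - base z + \<delta> / 3"
      by (rule eventually_best_less[OF _ e])
  qed
  from frequently_ex[OF frequently_eventually_frequently[OF freq ev]] obtain n where
    n: "- base x - \<delta> / 3 < best (Suc n) x - real (Suc n) * rate \<and>
      (\<forall>z\<in>?Z. best n z - real n * rate < - base z + \<delta> / 3)"
    by (rule exE)
  obtain ys where ys: "walk ys x" "length ys = Suc n" "best (Suc n) x < gain 0 ys x + \<delta> / 3"
    using best_less[OF x e] .
  then obtain y zs where yz: "ys = y # zs" by (metis length_Suc_conv)
  then have H: "(y, x) \<in> H" "walk zs (tau (y, x))" "length zs = n" using ys by auto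
  have "best n (tau (y, x)) - real n * rate < - base (tau (y, x)) + \<delta> / 3" using n H(1) by blast
  then have "base (tau (y, x)) - (A (y, x) - rate) \<le> base x + \<delta>"
    using n ys(3) gain_le_best[OF H(2,3)] unfolding yz by (simp add: algebra_simps)
  then show "\<exists>y. (y, x) \<in> H \<and> base (tau (y, x)) - (A (y, x) - rate) \<le> base x + \<delta>"
    using H(1) by blast
qed

lemma base_distortion:
  assumes "x \<in> X" "z \<in> X" "x 0 = z 0"
  shows "base x - base z \<le> distortion * d x z powr \<theta>"
proof -
  have "base x - base z \<le> distortion * d x z powr \<theta> + e" if "e > 0" for e
  proof -
    have e: "e / 2 > 0" using that by simp
    obtain n where "- base z - e / 2 < best n z - real n * rate" "best n x - real n * rate < - base x + e / 2"
      using frequently_ex[OF frequently_eventually_frequently[OF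
            frequently_best_greater[OF assms(2) e] eventually_best_less[OF assms(1) e]]] by blast
    moreover have "best n z \<le> best n x + distortion * d x z powr \<theta>"
      using best_distortion[OF assms(2,1)] assms(3) seq_dist_commute[of lam x z] by auto
    ultimately show ?thesis by (simp add: algebra_simps)
  qed
  then show ?thesis by (rule field_le_epsilon)
qed

lemma continuous_on_base: "continuous_on X base"
  using holder_of_locally_holder[OF distortion_nonneg base_distortion] by (rule continuous_on_of_holder)

lemma base_bounded: obtains B where "\<And>x. x \<in> X \<Longrightarrow> \<bar>base x\<bar> \<le> B"
  using bounded_of_locally_holder[OF distortion_nonneg base_distortion] by blast

section \<open>The maximal holonomic integral\<close>

lemma continuous_map_shift_iff:
  "continuous_map (shift_topology r M lam) euclideanreal g \<longleftrightarrow> continuous_on X g"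
  unfolding shift_topology_eq[OF lam] by simp

lemma integrable_on_hat_space:
  fixes g :: "symseq \<times> symseq \<Rightarrow> real"
  assumes "prob_space \<mu>" "sets \<mu> = sets (borel_of_topology (hat_topology r M lam))" "continuous_on H g"
  shows "integrable \<mu> g"
proof -
  interpret prob_space \<mu> by (rule assms)
  have "continuous_map (hat_topology r M lam) euclidean g"
    unfolding hat_topology_eq[OF lam] using assms(3) by simp
  then have "g \<in> borel_measurable \<mu>"
    using continuous_map_borel_measurable measurable_cong_sets[OF assms(2) refl] by blast
  moreover have "space \<mu> = H"
    using sets_eq_imp_space_eq[OF assms(2)] by (simp add: hat_topology_eq[OF lam])
  moreover obtain B where "\<And>p. p \<in> H \<Longrightarrow> \<bar>g p\<bar> \<le> B" using bounded_on_H[OF assms(3)] by blast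
  ultimately show ?thesis by (intro integrable_const_bound[where B = B] AE_I2) auto
qed

lemma continuous_on_compose_tau:
  assumes "continuous_on X g"
  shows "continuous_on H (\<lambda>p. g (tau p))"
  by (rule continuous_on_compose2[OF assms continuous_on_tau]) (auto intro: tau_mem)

lemma continuous_on_compose_snd:
  assumes "continuous_on X g"
  shows "continuous_on H (\<lambda>p. g (snd p))"
  by (rule continuous_on_compose2[OF assms continuous_on_snd[OF continuous_on_id]]) (auto intro: hat_mem_X)

text \<open>A holonomic measure integrates \<open>base \<circ> tau - base \<circ> snd\<close> to zero.\<close>

lemma holonomic_integral_le_rate:
  assumes "\<mu> \<in> holonomic r M lam"
  shows "(\<integral>p. A p \<partial>\<mu>) \<le> rate"
proof -
  have \<mu>: "prob_space \<mu>" "sets \<mu> = sets (borel_of_topology (hat_topology r M lam))"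
    using assms unfolding holonomic_def by auto
  interpret prob_space \<mu> by (rule \<mu>)
  have sp: "space \<mu> = H"
    using sets_eq_imp_space_eq[OF \<mu>(2)] by (simp add: hat_topology_eq[OF lam])
  note int = integrable_on_hat_space[OF \<mu>]
  have eq: "(\<integral>p. base (tau p) \<partial>\<mu>) = (\<integral>p. base (snd p) \<partial>\<mu>)"
    using assms continuous_on_base continuous_map_shift_iff unfolding holonomic_def by blast
  have i1: "integrable \<mu> (\<lambda>p. base (tau p))" "integrable \<mu> (\<lambda>p. base (snd p))" "integrable \<mu> A"
    using int continuous_on_compose_tau continuous_on_compose_snd continuous_on_base continuous_on_A by auto
  have "(\<integral>p. A p \<partial>\<mu>) \<le> (\<integral>p. (base (tau p) - base (snd p)) + rate \<partial>\<mu>)"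
  proof (rule integral_mono)
    fix p assume "p \<in> space \<mu>"
    then show "A p \<le> (base (tau p) - base (snd p)) + rate"
      using base_subaction[of "fst p" "snd p"] sp by simp
  qed (use i1 in auto)
  also have "\<dots> = rate" using i1 eq prob_space by simp
  finally show ?thesis .
qed

text \<open>The empirical measures of walks of growing length integrate \<open>g \<circ> tau - g \<circ> snd\<close> to a telescoping sum divided
by the length, which tends to zero, so that weak limits are holonomic. If the walks are almost optimal, the integrals
of \<open>A\<close> tend to \<open>rate\<close>.\<close>

lemma rate_attained: "\<exists>\<mu>\<in>holonomic r M lam. rate = (\<integral>p. A p \<partial>\<mu>)"
proof -
  obtain x where x: "x \<in> X" using nonempty by blast
  (* Positive lengths keep the empirical averages meaningful. *)
  have "\<exists>ys. walk ys x \<and> length ys = Suc n \<and> best (Suc n) x < gain 0 ys x + 1" for n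
    using best_less[OF x zero_less_one] by metis
  then obtain W where W: "\<And>n. walk (W n) x" "\<And>n. length (W n) = Suc n"
    "\<And>n. best (Suc n) x < gain 0 (W n) x + 1" by metis
  define P where "P n = map_pmf (\<lambda>j. steps (W n) x ! j) (pmf_of_set {..<Suc n})" for n
  have ne: "{..<Suc n} \<noteq> {}" for n by auto
  have sub: "set_pmf (P n) \<subseteq> H" for n
  proof -
    have "set_pmf (P n) = set (steps (W n) x)"
      unfolding P_def using ne[of n] by (simp add: set_pmf_of_set set_conv_nth W(2) image_def) blast
    then show ?thesis using W(1)[of n] by (simp add: walk_def)
  qed
  have ex: "measure_pmf.expectation (P n) g = (\<Sum>p\<leftarrow>steps (W n) x. g p) / Suc n" for n and g :: "_ \<Rightarrow> real"
  proof -
    have "measure_pmf.expectation (P n) g = (\<Sum>j<Suc n. g (steps (W n) x ! j)) / real (card {..<Suc n})"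
      unfolding P_def integral_map_pmf by (rule integral_pmf_of_set[OF ne finite_lessThan])
    also have "(\<Sum>j<Suc n. g (steps (W n) x ! j)) = (\<Sum>p\<leftarrow>steps (W n) x. g p)"
      unfolding sum_list_sum_nth length_map length_steps W(2) atLeast0LessThan
      by (rule sum.cong) (simp_all add: W(2))
    finally show ?thesis by simp
  qed
  obtain s \<mu> where s: "strict_mono (s :: nat \<Rightarrow> nat)" and \<mu>: "prob_space \<mu>"
    "sets \<mu> = sets (borel_of_topology (top_of_set H))"
    and conv: "\<And>g :: _ \<Rightarrow> real. continuous_on H g \<Longrightarrow>
      (\<lambda>n. measure_pmf.expectation (P (s n)) g) \<longlonglongrightarrow> integral\<^sup>L \<mu> g"
    using pmfs_on_compact_subconverge[where K = H and P = P and e = "hat_code r",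
        OF compact_hat_space continuous_on_hat_code inj_on_hat_code sub]
    by blast
  have small: "(\<lambda>n. c n / Suc n) \<longlonglongrightarrow> 0" if c: "\<And>n. \<bar>c n\<bar> \<le> B" for c :: "nat \<Rightarrow> real" and B
  proof (rule Lim_null_comparison)
    show "\<forall>\<^sub>F n in sequentially. norm (c n / Suc n) \<le> B * inverse (real (Suc n))"
      using c by (simp add: divide_inverse abs_mult mult_right_mono)
    show "(\<lambda>n. B * inverse (real (Suc n))) \<longlonglongrightarrow> 0"
      using tendsto_mult_right_zero[OF LIMSEQ_inverse_real_of_nat] .
  qed
  obtain K where K: "\<And>n x. x \<in> X \<Longrightarrow> \<bar>best n x - real n * rate\<bar> \<le> K" using best_rate by blast
  have "\<bar>gain 0 (W n) x - real (Suc n) * rate\<bar> \<le> K + 1" for n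
    using K[OF x, of "Suc n"] W(3)[of n] gain_le_best[OF W(1,2), of n] by linarith
  from small[OF this] have "(\<lambda>n. gain 0 (W n) x / Suc n - rate) \<longlonglongrightarrow> 0"
    by (simp add: field_simps)
  then have "(\<lambda>n. measure_pmf.expectation (P n) A) \<longlonglongrightarrow> rate"
    unfolding ex by (subst LIM_zero_iff[symmetric]) (simp add: gain_def)
  then have "(\<lambda>n. measure_pmf.expectation (P (s n)) A) \<longlonglongrightarrow> rate"
    using LIMSEQ_subseq_LIMSEQ[OF _ s] by (auto simp: o_def)
  then have A: "rate = integral\<^sup>L \<mu> A" using conv[OF continuous_on_A] LIMSEQ_unique by blast
  have \<mu>2: "sets \<mu> = sets (borel_of_topology (hat_topology r M lam))"
    using \<mu>(2) by (simp add: hat_topology_eq[OF lam])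
  have "(\<integral>p. f (tau p) \<partial>\<mu>) = (\<integral>p. f (snd p) \<partial>\<mu>)" if f: "continuous_on X f" for f :: "symseq \<Rightarrow> real"
  proof -
    note c = continuous_on_compose_tau[OF f] continuous_on_compose_snd[OF f]
    obtain B where B: "\<And>z. z \<in> X \<Longrightarrow> \<bar>f z\<bar> \<le> B"
      using compact_imp_bounded[OF compact_continuous_image[OF f compact_shift_space]]
      unfolding bounded_iff by auto
    have "\<bar>f (endpoint (W n) x) - f x\<bar> \<le> 2 * B" for n
      using B[OF x] B[OF endpoint_mem[OF x W(1)[of n]]] by linarith
    from small[OF this] have "(\<lambda>n. measure_pmf.expectation (P n) (\<lambda>p. f (tau p) - f (snd p))) \<longlonglongrightarrow> 0"
      unfolding ex steps_telescope .
    then have "(\<lambda>n. measure_pmf.expectation (P (s n)) (\<lambda>p. f (tau p) - f (snd p))) \<longlonglongrightarrow> 0"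
      using LIMSEQ_subseq_LIMSEQ[OF _ s] by (auto simp: o_def)
    moreover have "continuous_on H (\<lambda>p. f (tau p) - f (snd p))"
      using c by (intro continuous_on_diff)
    ultimately have "(\<integral>p. f (tau p) - f (snd p) \<partial>\<mu>) = 0" using conv LIMSEQ_unique by blast
    then show ?thesis
      using integrable_on_hat_space[OF \<mu>(1) \<mu>2 c(1)] integrable_on_hat_space[OF \<mu>(1) \<mu>2 c(2)] by simp
  qed
  then have "\<mu> \<in> holonomic r M lam"
    unfolding holonomic_def continuous_map_shift_iff using \<mu>(1) \<mu>2 by blast
  with A show ?thesis by blast
qed

theorem beta_eq_rate: "beta r M lam A = rate"
  unfolding beta_def
  by (rule Greatest_equality) (use rate_attained holonomic_integral_le_rate in auto)

section \<open>The Mane potential as a least cost\<close>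

text \<open>The walks that describe the paths from \<open>x'\<close> to within \<open>\<epsilon>\<close> of \<open>x\<close>, with the order of arguments of \<open>paths\<close>.\<close>

definition reaching :: "real \<Rightarrow> symseq \<Rightarrow> symseq \<Rightarrow> symseq list set" where
  "reaching \<epsilon> x x' = {ys. ys \<noteq> [] \<and> walk ys x' \<and> d (endpoint ys x') x < \<epsilon>}"

abbreviation "\<Omega> \<equiv> nonwandering r M lam A"
abbreviation "mane \<equiv> mane_potential r M lam A"

lemma paths_eq: "x' \<in> X \<Longrightarrow> paths r M lam x x' \<epsilon> = (\<lambda>ys. steps ys x') ` reaching \<epsilon> x x'"
proof (intro equalityI subsetI)
  fix p assume p: "p \<in> paths r M lam x x' \<epsilon>"
  then have eq: "steps (map fst p) x' = p"
    by (intro steps_map_fst) (auto simp: paths_def)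
  have "endpoint (map fst p) x' = tau (p ! (length p - 1))"
    using tau_last_step[of "map fst p" x'] p by (simp add: eq paths_def)
  then have "map fst p \<in> reaching \<epsilon> x x'"
    using p by (simp add: reaching_def walk_def eq paths_def)
  then show "p \<in> (\<lambda>ys. steps ys x') ` reaching \<epsilon> x x'" using eq by (metis imageI)
next
  fix p assume "p \<in> (\<lambda>ys. steps ys x') ` reaching \<epsilon> x x'"
  then obtain ys where ys: "p = steps ys x'" "ys \<noteq> []" "walk ys x'" "d (endpoint ys x') x < \<epsilon>"
    by (auto simp: reaching_def)
  then have "p \<noteq> []" "snd (p ! 0) = x'" by (cases ys; simp)+
  then show "p \<in> paths r M lam x x' \<epsilon>"
    using ys tau_last_step[OF ys(2), of x'] by (simp add: paths_def walk_def steps_chain)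
qed

lemma path_sum_steps: "path_sum r M lam A (steps ys x) = gain rate ys x"
  unfolding path_sum_def gain_def beta_eq_rate sum_list_sum_nth atLeast0LessThan by simp

lemma nonwandering_iff:
  "x \<in> \<Omega> \<longleftrightarrow> x \<in> X \<and> (\<forall>\<epsilon>>0. \<exists>ys\<in>reaching \<epsilon> x x. \<bar>gain rate ys x\<bar> < \<epsilon>)"
  unfolding nonwandering_def by (auto simp: paths_eq path_sum_steps)

lemma mane_eps_eq:
  "x' \<in> X \<Longrightarrow> mane_eps r M lam A \<epsilon> x x' = (INF ys\<in>reaching \<epsilon> x x'. ereal (- gain rate ys x'))"
  unfolding mane_eps_def by (simp add: paths_eq path_sum_steps image_image)

lemma mane_eps_antimono:
  "x' \<in> X \<Longrightarrow> \<epsilon> \<le> \<epsilon>' \<Longrightarrow> mane_eps r M lam A \<epsilon>' x x' \<le> mane_eps r M lam A \<epsilon> x x'"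
  unfolding mane_eps_eq by (rule INF_superset_mono) (auto simp: reaching_def)

text \<open>Shrinking \<open>\<epsilon>\<close> leaves fewer paths, so the limit is a monotone one.\<close>

lemma mane_eq_SUP:
  assumes x': "x' \<in> X"
  shows "mane x x' = (SUP \<epsilon>\<in>{0<..}. mane_eps r M lam A \<epsilon> x x')"
proof -
  let ?g = "\<lambda>\<epsilon>. mane_eps r M lam A \<epsilon> x x'"
  have "(?g \<longlongrightarrow> (SUP \<epsilon>\<in>{0<..}. ?g \<epsilon>)) (at_right 0)"
  proof (rule order_tendstoI)
    fix a assume "a < (SUP \<epsilon>\<in>{0<..}. ?g \<epsilon>)"
    then obtain e where e: "e > 0" "a < ?g e" by (auto simp: less_SUP_iff)
    then have "a < ?g \<epsilon>" if "\<epsilon> < e" for \<epsilon>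
      using mane_eps_antimono[OF x', of \<epsilon> e x] that by (simp add: less_le_trans)
    then show "eventually (\<lambda>\<epsilon>. a < ?g \<epsilon>) (at_right 0)"
      using e(1) eventually_at_right_field by blast
  next
    fix a assume a: "(SUP \<epsilon>\<in>{0<..}. ?g \<epsilon>) < a"
    have "?g \<epsilon> < a" if "\<epsilon> > 0" for \<epsilon>
      using a SUP_upper[of \<epsilon> "{0<..}" ?g] that by (simp add: le_less_trans)
    then show "eventually (\<lambda>\<epsilon>. ?g \<epsilon> < a) (at_right 0)"
      using eventually_at_right_less[of 0] by (auto elim: eventually_mono)
  qed
  then show ?thesis unfolding mane_potential_def by (intro tendsto_Lim) simp_all
qed

lemma mane_leI:
  assumes "x' \<in> X" "\<And>\<epsilon> \<delta>. \<epsilon> > 0 \<Longrightarrow> \<delta> > 0 \<Longrightarrow> \<exists>ys\<in>reaching \<epsilon> x x'. - gain rate ys x' \<le> c + \<delta>"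
  shows "mane x x' \<le> ereal c"
  unfolding mane_eq_SUP[OF assms(1)]
proof (rule SUP_least)
  fix \<epsilon> :: real assume "\<epsilon> \<in> {0<..}"
  then have e: "\<epsilon> > 0" by simp
  show "mane_eps r M lam A \<epsilon> x x' \<le> ereal c"
  proof (rule ereal_le_epsilon2)
    fix \<delta> :: real assume "\<delta> > 0"
    then obtain ys where ys: "ys \<in> reaching \<epsilon> x x'" "- gain rate ys x' \<le> c + \<delta>"
      using assms(2)[OF e] by blast
    then show "mane_eps r M lam A \<epsilon> x x' \<le> ereal c + ereal \<delta>"
      unfolding mane_eps_eq[OF assms(1)] by (intro INF_lower2[OF ys(1)]) simp
  qed
qed

lemma mane_leD:
  assumes "x' \<in> X" "mane x x' \<le> ereal c" "\<epsilon> > 0" "\<delta> > 0"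
  obtains ys where "ys \<in> reaching \<epsilon> x x'" "- gain rate ys x' < c + \<delta>"
proof -
  have "mane_eps r M lam A \<epsilon> x x' \<le> mane x x'"
    unfolding mane_eq_SUP[OF assms(1)] using assms(3) by (intro SUP_upper) simp
  also have "\<dots> \<le> ereal c" by (rule assms)
  also have "\<dots> < ereal (c + \<delta>)" using assms(4) by simp
  finally have "\<exists>ys\<in>reaching \<epsilon> x x'. ereal (- gain rate ys x') < ereal (c + \<delta>)"
    unfolding mane_eps_eq[OF assms(1)] INF_less_iff .
  then show thesis using that by auto
qed

lemma le_maneI:
  assumes "x' \<in> X" "\<And>\<delta>. \<delta> > 0 \<Longrightarrow> \<exists>\<epsilon>>0. \<forall>ys\<in>reaching \<epsilon> x x'. c - \<delta> \<le> - gain rate ys x'"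
  shows "ereal c \<le> mane x x'"
proof (rule ereal_le_epsilon2)
  fix \<delta> :: real assume "\<delta> > 0"
  then obtain \<epsilon> where e: "\<epsilon> > 0" "\<forall>ys\<in>reaching \<epsilon> x x'. c - \<delta> \<le> - gain rate ys x'"
    using assms(2) by blast
  then have "ereal (c - \<delta>) \<le> mane_eps r M lam A \<epsilon> x x'"
    unfolding mane_eps_eq[OF assms(1)] by (intro INF_greatest) simp
  also have "\<dots> \<le> mane x x'"
    unfolding mane_eq_SUP[OF assms(1)] using e(1) by (intro SUP_upper) simp
  finally show "ereal c \<le> mane x x' + ereal \<delta>"
    by (cases "mane x x'") auto
qed

lemma less_maneD:
  assumes "x' \<in> X" "ereal c < mane x x'"
  shows "\<exists>\<epsilon>>0. \<forall>ys\<in>reaching \<epsilon> x x'. c \<le> - gain rate ys x'"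
proof -
  obtain \<epsilon> where e: "\<epsilon> > 0" "ereal c < mane_eps r M lam A \<epsilon> x x'"
    using assms(2) unfolding mane_eq_SUP[OF assms(1)] less_SUP_iff by auto
  have "c \<le> - gain rate ys x'" if "ys \<in> reaching \<epsilon> x x'" for ys
  proof -
    have "ereal c < ereal (- gain rate ys x')"
      using e(2) INF_lower[OF that, of "\<lambda>ys. ereal (- gain rate ys x')"]
      unfolding mane_eps_eq[OF assms(1)] by (rule less_le_trans)
    then show ?thesis by simp
  qed
  with e(1) show ?thesis by blast
qed

section \<open>Non-wandering points\<close>

text \<open>The bound \<open>\<eta> \<le> 1\<close> ensures that points closer than \<open>\<eta>\<close> share their first symbol, so that walks can be
transferred between them.\<close>

lemma small_distortion:
  assumes "\<delta> > 0"
  obtains \<eta> where "0 < \<eta>" "\<eta> \<le> 1" "\<And>x z. d x z < \<eta> \<Longrightarrow> distortion * d x z powr \<theta> < \<delta>"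
proof -
  define C where "C = distortion + 1"
  have C: "C > 0" "distortion \<le> C" using distortion_nonneg by (auto simp: C_def)
  define \<eta> where "\<eta> = min 1 ((\<delta> / C) powr (1 / \<theta>))"
  have "distortion * d x z powr \<theta> < \<delta>" if "d x z < \<eta>" for x z
  proof -
    have "d x z < (\<delta> / C) powr (1 / \<theta>)" using that by (simp add: \<eta>_def)
    then have "d x z powr \<theta> < ((\<delta> / C) powr (1 / \<theta>)) powr \<theta>"
      using theta by (intro powr_less_mono2) auto
    also have "\<dots> = \<delta> / C" using theta assms C(1) by (simp add: powr_powr)
    finally have "C * d x z powr \<theta> < \<delta>" using C(1) by (simp add: field_simps)
    moreover have "distortion * d x z powr \<theta> \<le> C * d x z powr \<theta>"
      using C(2) by (intro mult_right_mono) auto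
    ultimately show ?thesis by linarith
  qed
  moreover have "0 < \<eta>" "\<eta> \<le> 1" using assms C(1) by (auto simp: \<eta>_def)
  ultimately show thesis using that by blast
qed

lemma d_ultra: "d x z \<le> max (d x y) (d y z)" by (rule seq_dist_ultra[OF lam])

lemma d_commute: "d x z = d z x" by (rule seq_dist_commute)

lemma d_endpoint_le: "d (endpoint ys x) (endpoint ys z) \<le> d x z"
  unfolding d_endpoint using lam by (intro mult_left_le_one_le) (auto intro: power_le_one)

lemma gain_le_base: "walk ys x \<Longrightarrow> gain rate ys x \<le> base (endpoint ys x) - base x"
proof (induction ys arbitrary: x)
  case (Cons y ys)
  then have "gain rate ys (tau (y, x)) \<le> base (endpoint ys (tau (y, x))) - base (tau (y, x))"
    by (intro Cons.IH) simp
  then show ?case using base_subaction[of y x] Cons.prems by simp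
qed simp

lemma base_distortion_abs:
  assumes "x \<in> X" "z \<in> X" "x 0 = z 0"
  shows "\<bar>base x - base z\<bar> \<le> distortion * d x z powr \<theta>"
  using base_distortion[OF assms] base_distortion[OF assms(2,1) assms(3)[symmetric]] d_commute[of z x]
  by (simp add: abs_le_iff)

text \<open>Following a calibrating choice at every step, the gain between two times is exactly the increment of \<open>base\<close>.\<close>

lemma calibrated_orbit:
  obtains s where "\<And>n. s n \<in> X"
    "\<And>n k. \<exists>ys. length ys = k \<and> walk ys (s n) \<and> endpoint ys (s n) = s (n + k) \<and>
      gain rate ys (s n) = base (s (n + k)) - base (s n)"
proof -
  obtain y where y: "\<And>x. x \<in> X \<Longrightarrow> (y x, x) \<in> H"
    "\<And>x. x \<in> X \<Longrightarrow> base (tau (y x, x)) - (A (y x, x) - rate) = base x"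
    using base_calibrated base_subaction by (metis order_antisym)
  obtain x where x: "x \<in> X" using nonempty by blast
  define s where "s n = ((\<lambda>x. tau (y x, x)) ^^ n) x" for n
  have s_Suc: "s (Suc n) = tau (y (s n), s n)" for n by (simp add: s_def)
  have s: "s n \<in> X" for n
    by (induction n) (use x y(1) tau_mem in \<open>auto simp: s_Suc\<close>, simp add: s_def)
  have "\<exists>ys. length ys = k \<and> walk ys (s n) \<and> endpoint ys (s n) = s (n + k) \<and>
      gain rate ys (s n) = base (s (n + k)) - base (s n)" for n k
  proof (induction k arbitrary: n)
    case (Suc k)
    obtain ys where "length ys = k" "walk ys (s (Suc n))" "endpoint ys (s (Suc n)) = s (Suc n + k)"
      "gain rate ys (s (Suc n)) = base (s (Suc n + k)) - base (s (Suc n))"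
      using Suc.IH by blast
    then show ?case using y[OF s[of n]]
      by (intro exI[of _ "y (s n) # ys"]) (simp add: s_Suc)
  qed simp
  with s show thesis by (rule that)
qed

text \<open>Between two visits of a calibrated orbit to a small neighbourhood of its cluster point, the gain is a difference of
nearby values of \<open>base\<close>. Starting the same walk at the cluster point itself gives a return with small gain.\<close>

lemma nonwandering_nonempty: "\<Omega> \<noteq> {}"
proof -
  obtain s where s: "\<And>n. s n \<in> X"
    and orbit: "\<And>n k. \<exists>ys. length ys = k \<and> walk ys (s n) \<and> endpoint ys (s n) = s (n + k) \<and>
      gain rate ys (s n) = base (s (n + k)) - base (s n)"
    using calibrated_orbit by blast
  from compact_cluster_point[of X s, OF compact_shift_space s]
  obtain x where x: "x \<in> X" "\<forall>U. open U \<longrightarrow> x \<in> U \<longrightarrow> (\<exists>\<^sub>F n in sequentially. s n \<in> U)"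
    by (rule bexE)
  have "\<exists>ys\<in>reaching \<epsilon> x x. \<bar>gain rate ys x\<bar> < \<epsilon>" if "\<epsilon> > 0" for \<epsilon>
  proof -
    have "\<epsilon> / 4 > 0" using that by simp
    then obtain \<eta> where \<eta>: "0 < \<eta>" "\<eta> \<le> 1" "\<And>x z. d x z < \<eta> \<Longrightarrow> distortion * d x z powr \<theta> < \<epsilon> / 4"
      using small_distortion by blast
    have "min \<eta> \<epsilon> > 0" using \<eta>(1) that by simp
    then obtain m where m: "lam ^ m < min \<eta> \<epsilon>" using power_small[OF lam] by blast
    have freq: "\<exists>\<^sub>F n in sequentially. s n \<in> cyl m x" using x(2) open_cyl by simp
    then obtain n where n: "s n \<in> cyl m x" using frequently_ex by blast
    obtain l where l: "s l \<in> cyl m x" "n < l"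
      using frequently_ex[OF frequently_eventually_frequently[OF freq eventually_gt_at_top[of n]]] by blast
    have dn: "d x (s n) < min \<eta> \<epsilon>" "d x (s l) < min \<eta> \<epsilon>"
      using n l(1) m seq_dist_le_power_iff[OF lam] by (meson le_less_trans)+
    have "d x (s n) < 1" "d x (s l) < 1" using dn \<eta>(2) by auto
    then have x0: "x 0 = s n 0" "x 0 = s l 0" unfolding d_less_1_iff .
    obtain ys where ys: "length ys = l - n" "walk ys (s n)" "endpoint ys (s n) = s l"
      "gain rate ys (s n) = base (s l) - base (s n)"
      using orbit[where n = n and k = "l - n"] l(2) by auto
    have "\<bar>base (s l) - base x\<bar> < \<epsilon> / 4" "\<bar>base (s n) - base x\<bar> < \<epsilon> / 4"
      using base_distortion_abs[OF s x(1) x0(1)[symmetric]] base_distortion_abs[OF s x(1) x0(2)[symmetric]]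
        \<eta>(3)[of "s n" x] \<eta>(3)[of "s l" x] dn d_commute[of x "s n"] d_commute[of x "s l"] by simp_all
    moreover have "\<bar>gain rate ys (s n) - gain rate ys x\<bar> < \<epsilon> / 4"
      using gain_distortion[OF ys(2) s x(1) x0(1)[symmetric], of rate] \<eta>(3)[of "s n" x] dn(1)
        d_commute[of x] by auto
    ultimately have "\<bar>gain rate ys x\<bar> < \<epsilon>" using ys(4) by linarith
    moreover have "d (endpoint ys x) x < \<epsilon>"
      using d_ultra[of "endpoint ys x" x "s l"] d_endpoint_le[of ys x "s n"] dn d_commute[of x "s l"]
      unfolding ys(3) by auto
    moreover have "walk ys x" using walk_cong[OF ys(2) x(1)] x0 by simp
    moreover have "ys \<noteq> []" using ys(1) l(2) by auto
    ultimately show ?thesis by (auto simp: reaching_def)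
  qed
  then have "x \<in> \<Omega>" using x(1) nonwandering_iff by blast
  then show ?thesis by blast
qed

lemma nonwandering_mem: "x \<in> \<Omega> \<Longrightarrow> x \<in> X"
  by (simp add: nonwandering_iff)

section \<open>Long walks towards non-wandering points\<close>

text \<open>A loop at \<open>x\<close> is transferred to the endpoint of a walk that comes close to \<open>x\<close>.\<close>

lemma reaching_append:
  assumes us: "us \<in> reaching \<eta> x x'" and vs: "vs \<in> reaching \<epsilon> x x"
    and x: "x \<in> X" "x' \<in> X" and le: "\<eta> \<le> \<epsilon>" "\<eta> \<le> 1"
    and \<eta>: "\<And>x z. d x z < \<eta> \<Longrightarrow> distortion * d x z powr \<theta> < \<delta>"
  shows "us @ vs \<in> reaching \<epsilon> x x'"
    and "gain rate us x' + gain rate vs x - \<delta> \<le> gain rate (us @ vs) x'"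
proof -
  let ?z = "endpoint us x'"
  have z: "?z \<in> X" using endpoint_mem x(2) us by (auto simp: reaching_def)
  have dz: "d ?z x < \<eta>" using us by (simp add: reaching_def)
  then have z0: "x 0 = ?z 0" using le(2) d_less_1_iff[of ?z x] by simp
  have vs': "walk vs x" "d (endpoint vs x) x < \<epsilon>" using vs by (auto simp: reaching_def)
  have "d (endpoint vs ?z) x < \<epsilon>"
    using d_ultra[of "endpoint vs ?z" x "endpoint vs x"] d_endpoint_le[of vs ?z x] dz vs'(2) le(1)
    by auto
  then show "us @ vs \<in> reaching \<epsilon> x x'"
    using us walk_cong[OF vs'(1) z z0] by (simp add: reaching_def walk_append endpoint_append)
  show "gain rate us x' + gain rate vs x - \<delta> \<le> gain rate (us @ vs) x'"
    using gain_distortion[OF vs'(1) x(1) z z0, of rate] \<eta>[of x ?z] dz d_commute[of x ?z]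
    unfolding gain_append by auto
qed

text \<open>Short returns are concatenated, each one so precise that the accumulated error stays small.\<close>

lemma long_loop:
  assumes x: "x \<in> \<Omega>" and "\<epsilon> > 0"
  shows "\<exists>ys\<in>reaching \<epsilon> x x. n \<le> length ys \<and> - \<epsilon> < gain rate ys x"
  using assms(2)
proof (induction n arbitrary: \<epsilon>)
  case 0
  then show ?case using x unfolding nonwandering_iff by (force simp: abs_less_iff)
next
  case (Suc n)
  then have e: "\<epsilon> / 3 > 0" by simp
  obtain \<eta> where \<eta>: "0 < \<eta>" "\<eta> \<le> 1" "\<And>x z. d x z < \<eta> \<Longrightarrow> distortion * d x z powr \<theta> < \<epsilon> / 3"
    using small_distortion[OF e] by blast
  define \<eta>' where "\<eta>' = min \<eta> (\<epsilon> / 3)"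
  have \<eta>': "\<eta>' > 0" "\<eta>' \<le> \<epsilon>" "\<eta>' \<le> 1" "\<And>x z. d x z < \<eta>' \<Longrightarrow> distortion * d x z powr \<theta> < \<epsilon> / 3"
    using \<eta> e unfolding \<eta>'_def by auto
  obtain us where us: "us \<in> reaching \<eta>' x x" "\<bar>gain rate us x\<bar> < \<eta>'"
    using x \<eta>'(1) unfolding nonwandering_iff by blast
  obtain vs where vs: "vs \<in> reaching (\<epsilon> / 3) x x" "n \<le> length vs" "- (\<epsilon> / 3) < gain rate vs x"
    using Suc.IH[OF e] by blast
  have vs': "vs \<in> reaching \<epsilon> x x" using vs(1) e by (auto simp: reaching_def)
  note xX = nonwandering_mem[OF x]
  note app = reaching_append[OF us(1) vs' xX xX \<eta>'(2-4)]
  have "\<eta>' \<le> \<epsilon> / 3" by (simp add: \<eta>'_def)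
  then have "- \<epsilon> < gain rate (us @ vs) x" using app(2) us(2) vs(3) by linarith
  moreover have "Suc n \<le> length (us @ vs)"
    using vs(2) us(1) by (cases us) (auto simp: reaching_def)
  ultimately show ?case using app(1) by blast
qed

text \<open>The first part comes close to \<open>x\<close> at almost minimal cost; a long loop at \<open>x\<close> of almost zero cost follows.\<close>

lemma long_walk:
  assumes x: "x \<in> \<Omega>" and x': "x' \<in> X" and c: "mane x x' \<le> ereal c" and "\<epsilon> > 0" "\<delta> > 0"
  obtains ys where "ys \<in> reaching \<epsilon> x x'" "n \<le> length ys" "- gain rate ys x' < c + \<delta>"
proof -
  have e: "\<delta> / 3 > 0" using assms by simp
  obtain \<eta> where \<eta>: "0 < \<eta>" "\<eta> \<le> 1" "\<And>x z. d x z < \<eta> \<Longrightarrow> distortion * d x z powr \<theta> < \<delta> / 3"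
    using small_distortion[OF e] by blast
  have m: "min \<eta> \<epsilon> > 0" "min (\<delta> / 3) \<epsilon> > 0" using \<eta>(1) e \<open>\<epsilon> > 0\<close> by auto
  obtain us where us: "us \<in> reaching (min \<eta> \<epsilon>) x x'" "- gain rate us x' < c + \<delta> / 3"
    using mane_leD[OF x' c m(1) e] .
  obtain vs where vs: "vs \<in> reaching (min (\<delta> / 3) \<epsilon>) x x" "n \<le> length vs"
      "- min (\<delta> / 3) \<epsilon> < gain rate vs x"
    using long_loop[OF x m(2)] by blast
  have vs': "vs \<in> reaching \<epsilon> x x" using vs(1) by (auto simp: reaching_def)
  have app: "us @ vs \<in> reaching \<epsilon> x x'"
    "gain rate us x' + gain rate vs x - \<delta> / 3 \<le> gain rate (us @ vs) x'"
    using reaching_append[OF us(1) vs' nonwandering_mem[OF x] x', of "\<delta> / 3"] \<eta> by auto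
  show thesis
  proof (rule that[OF app(1)])
    show "n \<le> length (us @ vs)" using vs(2) by simp
    show "- gain rate (us @ vs) x' < c + \<delta>" using app(2) us(2) vs(3) by linarith
  qed
qed

section \<open>Regularity and dynamics of the Mane potential\<close>

text \<open>Along a long walk the starting points \<open>x'\<close> and \<open>z'\<close> lead to nearby endpoints, so the same walk
competes in both infima, with gains that differ by at most the distortion.\<close>

lemma mane_distortion:
  assumes x: "x \<in> \<Omega>" and x': "x' \<in> X" "z' \<in> X" "x' 0 = z' 0" and c: "mane x x' \<le> ereal c"
  shows "mane x z' \<le> ereal (c + distortion * d x' z' powr \<theta>)"
proof (rule mane_leI[OF x'(2)])
  fix \<epsilon> \<delta> :: real assume "\<epsilon> > 0" "\<delta> > 0"
  obtain n where n: "lam ^ n < \<epsilon>" using power_small[OF lam \<open>\<epsilon> > 0\<close>] .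
  obtain ys where ys: "ys \<in> reaching \<epsilon> x x'" "n \<le> length ys" "- gain rate ys x' < c + \<delta>"
    using long_walk[OF x x'(1) c \<open>\<epsilon> > 0\<close> \<open>\<delta> > 0\<close>] .
  have ys': "ys \<noteq> []" "walk ys x'" "d (endpoint ys x') x < \<epsilon>" using ys(1) by (auto simp: reaching_def)
  have "d (endpoint ys z') (endpoint ys x') \<le> lam ^ length ys"
    unfolding d_endpoint using lam d_le_1 by (intro mult_left_le) auto
  also have "\<dots> \<le> lam ^ n" using lam ys(2) by (intro power_decreasing) auto
  finally have "d (endpoint ys z') x < \<epsilon>"
    using d_ultra[of "endpoint ys z'" x "endpoint ys x'"] n ys'(3) by auto
  then have "ys \<in> reaching \<epsilon> x z'"
    using ys' walk_cong[OF ys'(2) x'(2,3)] by (simp add: reaching_def)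
  moreover have "- gain rate ys z' \<le> c + distortion * d x' z' powr \<theta> + \<delta>"
    using gain_distortion[OF ys'(2) x', of rate] ys(3) by linarith
  ultimately show "\<exists>ys\<in>reaching \<epsilon> x z'. - gain rate ys z' \<le> c + distortion * d x' z' powr \<theta> + \<delta>"
    by blast
qed

text \<open>The cost of a walk is at least the decrease of \<open>base\<close> along it, by the sub-action inequality.\<close>

lemma base_le_mane:
  assumes x: "x \<in> X" "x' \<in> X"
  shows "ereal (base x' - base x) \<le> mane x x'"
proof (rule le_maneI[OF x(2)])
  fix \<delta> :: real assume "\<delta> > 0"
  obtain \<eta> where \<eta>: "0 < \<eta>" "\<eta> \<le> 1" "\<And>x z. d x z < \<eta> \<Longrightarrow> distortion * d x z powr \<theta> < \<delta>"
    using small_distortion[OF \<open>\<delta> > 0\<close>] by blast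
  have "base x' - base x - \<delta> \<le> - gain rate ys x'" if "ys \<in> reaching \<eta> x x'" for ys
  proof -
    let ?z = "endpoint ys x'"
    have z: "walk ys x'" "?z \<in> X" "d ?z x < \<eta>" using that endpoint_mem[OF x(2)] by (auto simp: reaching_def)
    then have "?z 0 = x 0" using \<eta>(2) d_less_1_iff[of ?z x] by simp
    then have "base ?z - base x \<le> \<delta>"
      using base_distortion[OF z(2) x(1)] \<eta>(3)[OF z(3)] by linarith
    then show ?thesis using gain_le_base[OF z(1)] by linarith
  qed
  then show "\<exists>\<epsilon>>0. \<forall>ys\<in>reaching \<epsilon> x x'. base x' - base x - \<delta> \<le> - gain rate ys x'"
    using \<eta>(1) by blast
qed

text \<open>Walk to a point with the first symbol of \<open>x\<close>, and imitate a long loop at \<open>x\<close> from there.\<close>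

lemma mane_nonwandering_finite:
  assumes x: "x \<in> \<Omega>" and x': "x' \<in> X"
  shows "\<exists>c. mane x x' \<le> ereal c"
proof -
  note xX = nonwandering_mem[OF x]
  obtain us where us: "walk us x'" "endpoint us x' 0 = x 0" using connecting_walk[OF xX x'] by blast
  let ?z = "endpoint us x'"
  have z: "?z \<in> X" using endpoint_mem[OF x' us(1)] .
  (* The imitated loop may start at distance one from x, which costs the full distortion. *)
  have "mane x x' \<le> ereal (- gain rate us x' + distortion)"
  proof (rule mane_leI[OF x'])
    fix \<epsilon> \<delta> :: real assume e: "\<epsilon> > 0" "\<delta> > 0"
    then have m: "min \<epsilon> \<delta> > 0" by simp
    obtain n where n: "lam ^ n < \<epsilon>" using power_small[OF lam e(1)] .
    obtain vs where vs: "vs \<in> reaching (min \<epsilon> \<delta>) x x" "n \<le> length vs"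
        "- min \<epsilon> \<delta> < gain rate vs x"
      using long_loop[OF x m] by blast
    have vs': "vs \<noteq> []" "walk vs x" "d (endpoint vs x) x < \<epsilon>" using vs(1) by (auto simp: reaching_def)
    have "d (endpoint vs ?z) (endpoint vs x) \<le> lam ^ length vs"
      unfolding d_endpoint using lam d_le_1 by (intro mult_left_le) auto
    also have "\<dots> \<le> lam ^ n" using lam vs(2) by (intro power_decreasing) auto
    finally have "d (endpoint vs ?z) x < \<epsilon>"
      using d_ultra[of "endpoint vs ?z" x "endpoint vs x"] n vs'(3) by auto
    then have "us @ vs \<in> reaching \<epsilon> x x'"
      using vs' us walk_cong[OF vs'(2) z] by (simp add: reaching_def walk_append endpoint_append)
    moreover have "distortion * d x ?z powr \<theta> \<le> distortion"
      using distortion_nonneg d_le_1 theta by (intro mult_left_le powr_le1) auto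
    then have "- gain rate (us @ vs) x' \<le> - gain rate us x' + distortion + \<delta>"
      using gain_distortion[OF vs'(2) xX z us(2)[symmetric], of rate] vs(3)
      unfolding gain_append by linarith
    ultimately show "\<exists>ys\<in>reaching \<epsilon> x x'. - gain rate ys x' \<le> - gain rate us x' + distortion + \<delta>"
      by blast
  qed
  then show ?thesis by blast
qed

definition mane_real :: "symseq \<Rightarrow> symseq \<Rightarrow> real" where
  "mane_real x x' = real_of_ereal (mane x x')"

lemma mane_eq_ereal:
  assumes "x \<in> \<Omega>" "x' \<in> X"
  shows "mane x x' = ereal (mane_real x x')"
proof -
  obtain c where "mane x x' \<le> ereal c" using mane_nonwandering_finite[OF assms] by blast
  moreover have "ereal (base x' - base x) \<le> mane x x'"
    using base_le_mane nonwandering_mem assms by blast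
  ultimately show ?thesis unfolding mane_real_def by (cases "mane x x'") auto
qed

lemma mane_real_distortion:
  assumes "x \<in> \<Omega>" "x' \<in> X" "z' \<in> X" "x' 0 = z' 0"
  shows "mane_real x z' \<le> mane_real x x' + distortion * d x' z' powr \<theta>"
  using mane_distortion[OF assms, of "mane_real x x'"] mane_eq_ereal assms by simp

lemma base_le_mane_real: "x \<in> \<Omega> \<Longrightarrow> x' \<in> X \<Longrightarrow> base x' - base x \<le> mane_real x x'"
  using base_le_mane[of x x'] mane_eq_ereal[of x x'] nonwandering_mem by simp

lemma mane_real_self:
  assumes "x \<in> \<Omega>"
  shows "mane_real x x \<le> 0"
proof -
  note xX = nonwandering_mem[OF assms]
  have "mane x x \<le> ereal 0"
  proof (rule mane_leI[OF xX])
    fix \<epsilon> \<delta> :: real assume "\<epsilon> > 0" "\<delta> > 0"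
    then have "min \<epsilon> \<delta> > 0" by simp
    then obtain ys where ys: "ys \<in> reaching (min \<epsilon> \<delta>) x x" "\<bar>gain rate ys x\<bar> < min \<epsilon> \<delta>"
      using assms unfolding nonwandering_iff by blast
    then have "ys \<in> reaching \<epsilon> x x" "- gain rate ys x \<le> 0 + \<delta>" by (auto simp: reaching_def)
    then show "\<exists>ys\<in>reaching \<epsilon> x x. - gain rate ys x \<le> 0 + \<delta>" by blast
  qed
  then show ?thesis using mane_eq_ereal[OF assms xX] by simp
qed

lemma mane_real_subaction:
  assumes x: "x \<in> \<Omega>" and H: "(y, x') \<in> H"
  shows "mane_real x x' \<le> mane_real x (tau (y, x')) - (A (y, x') - rate)"
proof -
  have X: "x' \<in> X" "tau (y, x') \<in> X" using hat_mem_X tau_mem H by auto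
  have "mane x x' \<le> ereal (mane_real x (tau (y, x')) - (A (y, x') - rate))"
  proof (rule mane_leI[OF X(1)])
    fix \<epsilon> \<delta> :: real assume "\<epsilon> > 0" "\<delta> > 0"
    then obtain ys where "ys \<in> reaching \<epsilon> x (tau (y, x'))"
      "- gain rate ys (tau (y, x')) < mane_real x (tau (y, x')) + \<delta>"
      using mane_leD[OF X(2), of x "mane_real x (tau (y, x'))"] mane_eq_ereal[OF x X(2)] by auto
    then show "\<exists>ys\<in>reaching \<epsilon> x x'. - gain rate ys x' \<le> mane_real x (tau (y, x')) - (A (y, x') - rate) + \<delta>"
      using H by (intro bexI[of _ "y # ys"]) (auto simp: reaching_def)
  qed
  then show ?thesis using mane_eq_ereal[OF x X(1)] by simp
qed

text \<open>Split the first step off a walk of almost minimal cost. The walk is taken of length at least two, because the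
remainder must be nonempty to count as a path. The lower bounds on the costs of the remainders are uniform over the finitely
many possible successors.\<close>

lemma mane_real_almost_calibrated:
  assumes x: "x \<in> \<Omega>" and x': "x' \<in> X" and "\<delta> > 0"
  shows "\<exists>y. (y, x') \<in> H \<and> mane_real x (tau (y, x')) - (A (y, x') - rate) \<le> mane_real x x' + \<delta>"
proof -
  let ?Z = "{tau (y, x') |y. (y, x') \<in> H}"
  let ?P = "\<lambda>\<epsilon> z. \<forall>ys\<in>reaching \<epsilon> x z. mane_real x z - \<delta> / 2 \<le> - gain rate ys z"
  have "\<forall>\<^sub>F \<epsilon> in at_right 0. ?P \<epsilon> z" if "z \<in> ?Z" for z
  proof -
    have z: "z \<in> X" using that tau_mem by auto
    have "ereal (mane_real x z - \<delta> / 2) < mane x z" using mane_eq_ereal[OF x z] \<open>\<delta> > 0\<close> by simp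
    from less_maneD[OF z this] obtain e where e: "e > 0" "?P e z" by blast
    have "?P \<epsilon> z" if "\<epsilon> < e" for \<epsilon>
      using e(2) that by (auto simp: reaching_def)
    then show ?thesis using e(1) eventually_at_right_field by blast
  qed
  then have "\<forall>\<^sub>F \<epsilon> in at_right 0. \<forall>z\<in>?Z. ?P \<epsilon> z"
    by (intro eventually_ball_finite finite_successors ballI)
  then have "\<forall>\<^sub>F \<epsilon> in at_right 0. (\<forall>z\<in>?Z. ?P \<epsilon> z) \<and> 0 < \<epsilon>"
    using eventually_at_right_less by (rule eventually_conj)
  then obtain \<epsilon> where e: "\<forall>z\<in>?Z. ?P \<epsilon> z" "0 < \<epsilon>"
    using eventually_happens'[OF trivial_limit_at_right_real] by blast
  have d2: "\<delta> / 2 > 0" using \<open>\<delta> > 0\<close> by simp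
  have c: "mane x x' \<le> ereal (mane_real x x')" using mane_eq_ereal[OF x x'] by simp
  obtain ys where ys: "ys \<in> reaching \<epsilon> x x'" "2 \<le> length ys" "- gain rate ys x' < mane_real x x' + \<delta> / 2"
    using long_walk[OF x x' c e(2) d2] .
  then obtain y zs where yz: "ys = y # zs" by (cases ys) auto
  have "zs \<noteq> []" using ys(2) yz by auto
  then have H: "(y, x') \<in> H" and "zs \<in> reaching \<epsilon> x (tau (y, x'))"
    using ys(1) yz \<open>zs \<noteq> []\<close> by (auto simp: reaching_def)
  then have "mane_real x (tau (y, x')) - \<delta> / 2 \<le> - gain rate zs (tau (y, x'))" using e(1) by blast
  then have "mane_real x (tau (y, x')) - (A (y, x') - rate) \<le> mane_real x x' + \<delta>"
    using ys(3) unfolding yz by simp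
  with H show ?thesis by blast
qed

end

section \<open>Sub-actions from boundary data on the non-wandering set\<close>

theorem theorem12:
  fixes r :: nat
    and M :: "nat \<Rightarrow> nat \<Rightarrow> nat"
    and lam \<theta> :: real
    and A :: "(nat \<Rightarrow> nat) \<times> (nat \<Rightarrow> nat) \<Rightarrow> real"
    and f :: "(nat \<Rightarrow> nat) \<Rightarrow> real"
  assumes "\<And>i j. i \<in> {1..r} \<Longrightarrow> j \<in> {1..r} \<Longrightarrow> M i j \<in> {0, 1}"
    and "shift_space r M \<noteq> {}"
    and "0 < lam" and "lam < 1"
    and "topologically_transitive (shift_topology r M lam) left_shift"
    and "0 < \<theta>"
    and "holder_on (hat_space r M) (hat_dist lam) \<theta> A"
    and "bdd_below (f ` nonwandering r M lam A)"
  shows "\<exists>u :: (nat \<Rightarrow> nat) \<Rightarrow> real.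
    (\<forall>x'\<in>shift_space r M.
      ereal (u x') = (INF x\<in>nonwandering r M lam A. ereal (f x) + mane_potential r M lam A x x')) \<and>
    holder_on (shift_space r M) (seq_dist lam) \<theta> u \<and>
    calibrated_subaction r M lam A u \<and>
    ((\<forall>x\<in>nonwandering r M lam A. \<forall>x'\<in>nonwandering r M lam A.
        ereal (f x' - f x) \<le> mane_potential r M lam A x x') \<longrightarrow>
      (\<forall>x\<in>nonwandering r M lam A. u x = f x))"
proof -
  interpret holder_subshift r M lam \<theta> A
    using assms(2-7) by unfold_locales
  obtain m where m: "\<And>x. x \<in> \<Omega> \<Longrightarrow> m \<le> f x" using assms(8) by (auto simp: bdd_below_def)
  obtain B where B: "\<And>x. x \<in> X \<Longrightarrow> \<bar>base x\<bar> \<le> B" using base_bounded by blast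
  define u where "u x' = (INF x\<in>\<Omega>. f x + mane_real x x')" for x'
  have low: "m - 2 * B \<le> f x + mane_real x x'" if "x \<in> \<Omega>" "x' \<in> X" for x x'
    using m[OF that(1)] base_le_mane_real[OF that] B[OF that(2)] B[OF nonwandering_mem[OF that(1)]] by linarith
  then have bdd: "bdd_below ((\<lambda>x. f x + mane_real x x') ` \<Omega>)" if "x' \<in> X" for x'
    using that by (intro bdd_belowI2)
  have u_le: "u x' \<le> f x + mane_real x x'" if "x \<in> \<Omega>" "x' \<in> X" for x x'
    unfolding u_def using that bdd by (intro cINF_lower)
  have le_u: "c \<le> u x'" if "\<And>x. x \<in> \<Omega> \<Longrightarrow> c \<le> f x + mane_real x x'" for c x'
    unfolding u_def using that nonwandering_nonempty by (intro cINF_greatest)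
  have formula: "ereal (u x') = (INF x\<in>\<Omega>. ereal (f x) + mane x x')" if x': "x' \<in> X" for x'
  proof -
    have "(INF x\<in>\<Omega>. ereal (f x) + mane x x') = (INF x\<in>\<Omega>. ereal (f x + mane_real x x'))"
      by (rule INF_cong) (simp_all add: mane_eq_ereal[OF _ x'])
    also have "\<dots> = ereal (u x')"
    proof (rule antisym)
      obtain w where w: "w \<in> \<Omega>" using nonwandering_nonempty by blast
      have "ereal (m - 2 * B) \<le> (INF x\<in>\<Omega>. ereal (f x + mane_real x x'))"
        using low[OF _ x'] by (intro INF_greatest) simp
      moreover have "(INF x\<in>\<Omega>. ereal (f x + mane_real x x')) \<le> ereal (f w + mane_real w x')"
        using w by (rule INF_lower)
      ultimately obtain c where c: "(INF x\<in>\<Omega>. ereal (f x + mane_real x x')) = ereal c"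
        by (cases "INF x\<in>\<Omega>. ereal (f x + mane_real x x')") auto
      have "c \<le> u x'"
      proof (rule le_u)
        fix x assume "x \<in> \<Omega>"
        then have "(INF x\<in>\<Omega>. ereal (f x + mane_real x x')) \<le> ereal (f x + mane_real x x')" by (rule INF_lower)
        then show "c \<le> f x + mane_real x x'" unfolding c by simp
      qed
      then show "(INF x\<in>\<Omega>. ereal (f x + mane_real x x')) \<le> ereal (u x')" unfolding c by simp
    next
      show "ereal (u x') \<le> (INF x\<in>\<Omega>. ereal (f x + mane_real x x'))"
        using u_le[OF _ x'] by (intro INF_greatest) simp
    qed
    finally show ?thesis ..
  qed
  have "u x' - u z' \<le> distortion * d x' z' powr \<theta>" if "x' \<in> X" "z' \<in> X" "x' 0 = z' 0" for x' z'
  proof -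
    have "u x' - distortion * d x' z' powr \<theta> \<le> u z'"
    proof (rule le_u)
      fix x assume x: "x \<in> \<Omega>"
      show "u x' - distortion * d x' z' powr \<theta> \<le> f x + mane_real x z'"
        using u_le[OF x that(1)] mane_real_distortion[OF x that(2,1) that(3)[symmetric]] d_commute[of x' z'] by simp
    qed
    then show ?thesis by simp
  qed
  then have holder_u: "holder_on X d \<theta> u" by (rule holder_of_locally_holder[OF distortion_nonneg])
  have sub: "u x' \<le> u (tau (y, x')) - (A (y, x') - rate)" if H: "(y, x') \<in> H" for x' y
  proof -
    have "u x' + (A (y, x') - rate) \<le> u (tau (y, x'))"
    proof (rule le_u)
      fix x assume x: "x \<in> \<Omega>"
      show "u x' + (A (y, x') - rate) \<le> f x + mane_real x (tau (y, x'))"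
        using u_le[OF x hat_mem_X[OF H]] mane_real_subaction[OF x H] by simp
    qed
    then show ?thesis by simp
  qed
  (* A point x that almost attains the infimum provides an almost calibrating y. *)
  have cal: "\<exists>y. (y, x') \<in> H \<and> u (tau (y, x')) - (A (y, x') - rate) \<le> u x'" if x': "x' \<in> X" for x'
  proof (rule minimum_over_fibre_attained[OF x'])
    fix \<delta> :: real assume "\<delta> > 0"
    then have "\<not> (u x' + \<delta> / 2 \<le> u x')" by simp
    then obtain x where x: "x \<in> \<Omega>" "f x + mane_real x x' < u x' + \<delta> / 2"
      using le_u[of "u x' + \<delta> / 2" x'] not_le by blast
    have "\<delta> / 2 > 0" using \<open>\<delta> > 0\<close> by simp
    then obtain y where y: "(y, x') \<in> H" "mane_real x (tau (y, x')) - (A (y, x') - rate) \<le> mane_real x x' + \<delta> / 2"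
      using mane_real_almost_calibrated[OF x(1) x'] by blast
    have "u (tau (y, x')) - (A (y, x') - rate) \<le> u x' + \<delta>"
      using u_le[OF x(1) tau_mem[OF y(1)]] y(2) x(2) by simp
    with y(1) show "\<exists>y. (y, x') \<in> H \<and> u (tau (y, x')) - (A (y, x') - rate) \<le> u x' + \<delta>" by blast
  qed
  have "calibrated_subaction r M lam A u"
    unfolding calibrated_subaction_def beta_eq_rate continuous_map_shift_iff
  proof (intro conjI ballI)
    show "continuous_on X u" by (rule continuous_on_of_holder[OF holder_u])
    fix x' assume x': "x' \<in> X"
    obtain y where y: "(y, x') \<in> H" "u (tau (y, x')) - (A (y, x') - rate) \<le> u x'"
      using cal[OF x'] by blast
    then have "u x' = u (tau (y, x')) - A (y, x') + rate" using sub[OF y(1)] by linarith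
    then show "\<exists>y\<in>fibre x'. u x' = u (tau (y, x')) - A (y, x') + rate"
      using y(1) fibre_iff[OF x'] by blast
    show "u x' \<le> u (tau (y, x')) - A (y, x') + rate" if "y \<in> fibre x'" for y
      using sub[of y x'] that fibre_iff[OF x'] by simp
  qed
  moreover have "u x' = f x'"
    if le: "\<forall>x\<in>\<Omega>. \<forall>x'\<in>\<Omega>. ereal (f x' - f x) \<le> mane x x'" and x': "x' \<in> \<Omega>" for x'
  proof (rule antisym)
    note X = nonwandering_mem[OF x']
    show "u x' \<le> f x'" using u_le[OF x' X] mane_real_self[OF x'] by linarith
    show "f x' \<le> u x'"
    proof (rule le_u)
      fix x assume x: "x \<in> \<Omega>"
      then have "ereal (f x' - f x) \<le> ereal (mane_real x x')" using le x' mane_eq_ereal[OF x X] by metis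
      then show "f x' \<le> f x + mane_real x x'" by simp
    qed
  qed
  ultimately show ?thesis using formula holder_u by (intro exI[of _ u]) blast
qed

end
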